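(* Let $G$ be a finite group, $p$ an odd prime divisor of $|G|$ with $(p-1,|G|)=1$, and $S$ a Sylow $p$-subgroup of $G$. Suppose that every maximal subgroup of $S$ satisfies the $S$-subnormalizer condition in $G$, and, if $S$ is not cyclic, suppose additionally that $S$ has more than one abelian maximal subgroup. Then $G$ is $p$-nilpotent.
   Context: For a finite group $G$ and $S\in\mathrm{Syl}_p(G)$, a subgroup $H\le S$ satisfies the $S$-subnormalizer condition in $G$ if $N_G(K)\le N_G(H)$ for every subgroup $K$ with $H\le K\le S$. *)

theory Defs
  imports "HOL-Algebra.Algebra"
begin

definition sylow_subgroup :: "nat \<Rightarrow> 'a set \<Rightarrow> ('a, 'b) monoid_scheme \<Rightarrow> bool"
  where "sylow_subgroup p S G \<longleftrightarrow>
    subgroup S G \<and> card S = p ^ multiplicity p (order G)"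

definition maximal_subgroup :: "'a set \<Rightarrow> ('a, 'b) monoid_scheme \<Rightarrow> bool"
  where "maximal_subgroup M G \<longleftrightarrow>
    subgroup M G \<and> M \<noteq> carrier G \<and>
    (\<forall>K. subgroup K G \<longrightarrow> M \<subseteq> K \<longrightarrow> K = M \<or> K = carrier G)"

definition subnormalizer_condition :: "('a, 'b) monoid_scheme \<Rightarrow> 'a set \<Rightarrow> 'a set \<Rightarrow> bool"
  where "subnormalizer_condition G S H \<longleftrightarrow>
    (\<forall>K. subgroup K G \<longrightarrow> H \<subseteq> K \<longrightarrow> K \<subseteq> S \<longrightarrow> normalizer G K \<subseteq> normalizer G H)"

text \<open>\<open>G\<close> is \<open>p\<close>-nilpotent if it has a normal \<open>p\<close>-complement, i.e. a normal \<open>p'\<close>-subgroup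
  whose quotient is a \<open>p\<close>-group.\<close>

definition p_nilpotent :: "nat \<Rightarrow> ('a, 'b) monoid_scheme \<Rightarrow> bool"
  where "p_nilpotent p G \<longleftrightarrow>
    (\<exists>N. N \<lhd> G \<and> \<not> p dvd card N \<and> (\<exists>k. order (G Mod N) = p ^ k))"

end

(*
For x in S with x^p = 1 the transfer V : G -> S/S' satisfies V x = T x, where T multiplies the
conjugates of x over the cosets of S fixed by S, i.e. over N_G(S)/S: all other contributions cancel,
because S' is central of order at most p (two abelian maximal subgroups) and p is odd.
Since N_G(S) normalizes every maximal subgroup M of S and gcd(p - 1, |G|) = 1, it acts trivially on S/M,
so modulo M the map T is a power map with exponent prime to p; hence T is onto S/S', with kernel S'.
So the solutions of x^p = 1 in Q = S \<inter> ker V lie in S', which forces Q to be abelian, and the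
transfer of ker V into Q then has a p'-group as kernel: if z in Q has order p, all conjugates of z in Q
lie in <z>, hence equal z by the same coprimality, so z is not in the kernel.
A cyclic S is handled by this last step alone.
*)
theory Submission
  imports Defs "HOL-Number_Theory.Residues"
begin

section \<open>Fixed points of \<open>p\<close>-groups and products over cycles\<close>

text \<open>The argument that settles a cyclic \<open>S\<close> works for any abelian Sylow subgroup
  with at most \<open>p\<close> solutions of \<open>x^p = 1\<close>. A non-cyclic \<open>S\<close>
  need not be of this kind, so it is traded for \<open>Q\<close>, a Sylow subgroup of the normal
  subgroup \<open>ker V\<close>, which has \<open>p\<close>-power index in \<open>G\<close>. The
  obstacle is that \<open>V\<close> is not computed on all of \<open>S\<close>: orbits of non-fixed
  cosets cancel because their factors have order dividing \<open>p\<close>, and this is where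
  \<open>x^p = 1\<close> enters. Hence only the solutions of \<open>x^p = 1\<close> in
  \<open>Q\<close> are controlled, and commutativity has to be extracted from their number. This is
  possible because \<open>x -> x^p\<close> is a homomorphism on \<open>S\<close> with central
  values: two non-commuting elements of \<open>Q\<close> would produce a subgroup of index at least
  \<open>p^2\<close>, whereas the power map bounds that index by \<open>p\<close>. The exponent
  attached to \<open>T\<close> is the number of cosets fixed by all of \<open>S\<close>, which is
  congruent to the index of \<open>S\<close> modulo \<open>p\<close>. Since \<open>T\<close> also
  kills \<open>S'\<close>, surjectivity onto the finite group \<open>S/S'\<close> leaves no room for
  a larger kernel.\<close>

lemma (in group_action) card_cong_fixed_points:
  assumes "order G = p ^ k" and p: "Factorial_Ring.prime p" and "finite E"
  shows "[card E = card {x \<in> E. \<forall>g \<in> carrier G. \<phi> g x = x}] (mod p)"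
proof -
  let ?fix = "\<lambda>x. \<forall>g \<in> carrier G. \<phi> g x = x"
  interpret G: group G using group_hom group_hom.axioms(1) by auto
  have orb: "[(\<Sum>x\<in>orb. 1) = (\<Sum>x\<in>orb. if ?fix x then 1 else 0::nat)] (mod p)"
    if orb: "orb \<in> orbits G E \<phi>" for orb
  proof -
    obtain x where x: "x \<in> E" "orb = orbit G \<phi> x" using orb by (auto simp: orbits_def)
    have "x \<in> orb" using x orbit_refl by simp
    show ?thesis
    proof (cases "card orb = 1")
      case True
      then have "orb = {x}" using \<open>x \<in> orb\<close> by (metis card_1_singletonE singletonD)
      moreover have "?fix x"
        using \<open>orb = {x}\<close> x by (auto simp: orbit_def)
      ultimately show ?thesis by simp
    next
      case False
      have "card orb dvd p ^ k" using orbit_stabilizer_theorem[OF x(1)] assms(1) x(2) by (metis dvd_triv_left)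
      then have "p dvd card orb" using False p
        by (metis (no_types, lifting) divides_primepow_nat dvd_power gr_zeroI power_0)
      moreover have "\<not> ?fix y" if "y \<in> orb" for y
      proof
        assume fixy: "?fix y"
        have "\<exists>g \<in> carrier G. y = \<phi> g x" using that unfolding x(2) orbit_def by blast
        then obtain g where g: "g \<in> carrier G" "\<phi> g x = y" by auto
        have "x = y" using fixy orbit_sym_aux[OF g(1) x(1) g(2)] g(1) by auto
        then have "orb = {x}" using fixy x \<open>x \<in> orb\<close> by (auto simp: orbit_def)
        with False show False by simp
      qed
      then have "(\<Sum>x\<in>orb. if ?fix x then 1 else 0::nat) = 0" by (intro sum.neutral) auto
      ultimately show ?thesis by (simp add: cong_0_iff)
    qed
  qed
  have "card E = (\<Sum>orb\<in>orbits G E \<phi>. \<Sum>x\<in>orb. 1)"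
    using disjoint_sum[OF assms(3), of "\<lambda>_. 1::nat"] by simp
  moreover have "card {x \<in> E. ?fix x} = (\<Sum>orb\<in>orbits G E \<phi>. \<Sum>x\<in>orb. if ?fix x then 1 else 0)"
    using disjoint_sum[OF assms(3), of "\<lambda>x. if ?fix x then 1 else 0::nat"] assms(3)
    by (simp add: sum.If_cases Int_def)
  ultimately show ?thesis using cong_sum[of "orbits G E \<phi>", OF orb] by simp
qed

lemma (in group) r_coset_cancel:
  assumes "c \<subseteq> carrier G" "c' \<subseteq> carrier G" "x \<in> carrier G" "c #> x = c' #> x"
  shows "c = c'"
  by (metis assms coset_mult_assoc coset_mult_one inv_closed r_inv)

lemma (in group) card_cong_fixed_r_cosets:
  assumes P: "subgroup P G" "card P = p ^ k" and p: "Factorial_Ring.prime p"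
    and Y: "finite Y" "Y \<subseteq> Pow (carrier G)" "\<And>c s. c \<in> Y \<Longrightarrow> s \<in> P \<Longrightarrow> c #> s \<in> Y"
  shows "[card Y = card {c \<in> Y. \<forall>s \<in> P. c #> s = c}] (mod p)"
proof -
  \<comment> \<open>Translation from the right is a right action; the inverse turns it into a left
    one, and restricting it to \<open>Y\<close> is what membership in \<open>Bij Y\<close>
    demands.\<close>
  let ?\<phi> = "\<lambda>s. \<lambda>c\<in>Y. c #> inv s"
  let ?P = "G\<lparr>carrier := P\<rparr>"
  interpret P: subgroup P G by (rule P)
  have bij: "?\<phi> s \<in> Bij Y" if "s \<in> P" for s
  proof -
    have "bij_betw (\<lambda>c. c #> inv s) Y Y"
    proof (rule bij_betwI[where g = "\<lambda>c. c #> s"])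
      show "(\<lambda>c. c #> inv s) \<in> Y \<rightarrow> Y" "(\<lambda>c. c #> s) \<in> Y \<rightarrow> Y" using Y that by auto
    qed (use Y that in \<open>auto simp: coset_mult_assoc Pow_def subset_iff\<close>)
    then show ?thesis by (auto simp: Bij_def cong: bij_betw_cong)
  qed
  have hom: "?\<phi> \<in> hom ?P (BijGroup Y)"
  proof (rule homI)
    fix s t assume st: "s \<in> carrier ?P" "t \<in> carrier ?P"
    have "?\<phi> (s \<otimes> t) = compose Y (?\<phi> s) (?\<phi> t)"
      using Y st by (intro ext) (auto simp: compose_def inv_mult_group coset_mult_assoc Pow_def subset_iff)
    then show "?\<phi> (s \<otimes>\<^bsub>?P\<^esub> t) = ?\<phi> s \<otimes>\<^bsub>BijGroup Y\<^esub> ?\<phi> t"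
      using bij st by (simp add: BijGroup_def)
  qed (use bij in \<open>simp add: BijGroup_def\<close>)
  interpret group_action ?P Y ?\<phi>
    using hom P.subgroup_is_group[OF is_group] group_BijGroup
    by (simp add: group_action_def group_hom_def group_hom_axioms_def)
  have "(\<forall>g\<in>P. c #> inv g = c) \<longleftrightarrow> (\<forall>s\<in>P. c #> s = c)" if "c \<in> Y" for c
    by (metis P.mem_carrier P.m_inv_closed inv_inv)
  then have "{c \<in> Y. \<forall>s\<in>P. c #> s = c} = {c \<in> Y. \<forall>g\<in>carrier ?P. ?\<phi> g c = c}"
    by auto
  then show ?thesis
    using card_cong_fixed_points[of p k] assms by (simp add: order_def)
qed

lemma (in group_hom) order_eq_card_kernel_image:
  shows "order G = card (kernel G H h) * card (h ` carrier G)"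
proof -
  have "(\<lambda>Z. the_elem (h ` Z)) ` carrier (G Mod kernel G H h) = h ` carrier G"
  proof -
    have "the_elem (h ` (kernel G H h #>\<^bsub>G\<^esub> g)) = h g" if "g \<in> carrier G" for g
    proof -
      have "h ` (kernel G H h #>\<^bsub>G\<^esub> g) = {h g}"
        using that by (fastforce simp: kernel_def r_coset_def image_iff)
      then show ?thesis by simp
    qed
    then show ?thesis by (simp add: carrier_FactGroup image_image)
  qed
  then have "card (rcosets\<^bsub>G\<^esub> (kernel G H h)) = card (h ` carrier G)"
    using card_image[OF FactGroup_inj_on] by (simp add: FactGroup_def)
  then show ?thesis using G.lagrange[OF subgroup_kernel] by (simp add: mult.commute)
qed

text \<open>A permutation whose \<open>p\<close>-th power is the identity has only fixed points and
  \<open>p\<close>-cycles. Removing a whole cycle leaves a smaller invariant set, so cycles with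
  product 1 can be discarded one at a time.\<close>

lemma (in comm_monoid) finprod_prime_cycles:
  assumes "Factorial_Ring.prime p" "finite Y" "\<sigma> \<in> Y \<rightarrow> Y" "\<And>c. c \<in> Y \<Longrightarrow> (\<sigma> ^^ p) c = c"
    and "f \<in> Y \<rightarrow> carrier G"
    and "\<And>c. c \<in> Y \<Longrightarrow> \<sigma> c \<noteq> c \<Longrightarrow> (\<Otimes>j\<in>{..<p}. f ((\<sigma> ^^ j) c)) = \<one>"
  shows "finprod G f Y = finprod G f {c \<in> Y. \<sigma> c = c}"
  using assms(2-)
proof (induction "card Y" arbitrary: Y rule: less_induct)
  case less
  note p = assms(1)
  show ?case
  proof (cases "\<forall>c\<in>Y. \<sigma> c = c")
    case True
    then have "{c \<in> Y. \<sigma> c = c} = Y" by auto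
    then show ?thesis by simp
  next
    case False
    then obtain c where c: "c \<in> Y" "\<sigma> c \<noteq> c" by auto
    let ?O = "(\<lambda>j. (\<sigma> ^^ j) c) ` {..<p}"
    have pow: "(\<sigma> ^^ j) c \<in> Y" for j using c(1) less.prems(2) by (induction j) auto
    have powp: "(\<sigma> ^^ (a + p * j)) c = (\<sigma> ^^ a) c" for j a
    proof (induction j)
      case (Suc j)
      have "(\<sigma> ^^ (a + p * Suc j)) c = (\<sigma> ^^ p) ((\<sigma> ^^ (a + p * j)) c)"
        by (simp add: funpow_add[symmetric, THEN fun_cong, unfolded o_def] add_ac)
      then show ?case using less.prems(3)[OF pow] Suc by simp
    qed simp
    have inj: "inj_on (\<lambda>j. (\<sigma> ^^ j) c) {..<p}"
    proof (rule linorder_inj_onI)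
      fix i j assume ij: "i < j" "i \<in> {..<p}" "j \<in> {..<p}"
      show "(\<sigma> ^^ i) c \<noteq> (\<sigma> ^^ j) c"
      proof
        assume eq: "(\<sigma> ^^ i) c = (\<sigma> ^^ j) c"
        \<comment> \<open>Coinciding iterates make \<open>\<sigma> ^^ d\<close> fix \<open>c\<close>
          with \<open>0 < d < p\<close>. Bezout combines this with \<open>\<sigma> ^^ p\<close> to
          make \<open>\<sigma>\<close> itself fix \<open>c\<close>.\<close>
        define d where "d = j - i"
        have "(\<sigma> ^^ (p - i)) ((\<sigma> ^^ i) c) = c" using powp[of 0 1] ij
          by (simp add: funpow_add[symmetric, THEN fun_cong, unfolded o_def])
        moreover have "(\<sigma> ^^ (p - i)) ((\<sigma> ^^ j) c) = (\<sigma> ^^ d) c" using powp[of d 1] ij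
          by (simp add: funpow_add[symmetric, THEN fun_cong, unfolded o_def] d_def add.commute[of p])
        ultimately have d: "(\<sigma> ^^ d) c = c" using eq by simp
        then have dm: "(\<sigma> ^^ (d * m)) c = c" for m
          by (induction m) (simp_all add: funpow_add)
        have "coprime d p" using ij p unfolding d_def
          by (metis coprime_commute diff_le_self dvd_imp_le le_less_trans lessThan_iff
              linorder_not_le prime_imp_coprime zero_less_diff)
        then obtain m y where "d * m = p * y + 1"
          using bezout_nat[of d p] ij d_def by auto
        then have "\<sigma> c = c" using dm[of m] powp[of 1 y] by (simp add: add.commute)
        with c(2) show False by simp
      qed
    qed auto
    have inO: "(\<sigma> ^^ j) c \<in> ?O" for j
    proof -
      have "(\<sigma> ^^ j) c = (\<sigma> ^^ (j mod p)) c" using powp[of "j mod p" "j div p"] by simp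
      then show ?thesis using p by (auto simp: prime_gt_0_nat)
    qed
    have O_X: "?O \<subseteq> Y" using pow by auto
    have sig: "\<sigma> y \<in> Y - ?O" if "y \<in> Y - ?O" for y
    proof -
      have "\<sigma> y \<notin> ?O"
      proof
        assume "\<sigma> y \<in> ?O"
        then obtain j where "\<sigma> y = (\<sigma> ^^ j) c" by auto
        then have "(\<sigma> ^^ (p-1)) (\<sigma> y) = (\<sigma> ^^ (p - 1 + j)) c" by (simp add: funpow_add)
        moreover have "(\<sigma> ^^ (p-1)) (\<sigma> y) = y" using less.prems(3)[of y] that p
          by (metis DiffD1 Suc_diff_1 comp_apply funpow_Suc_right prime_gt_0_nat)
        ultimately show False using that inO by auto
      qed
      then show ?thesis using that less.prems(2) by auto
    qed
    have nofix: "\<sigma> y \<noteq> y" if "y \<in> ?O" for y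
    proof
      assume fy: "\<sigma> y = y"
      obtain j where j: "j < p" "y = (\<sigma> ^^ j) c" using \<open>y \<in> ?O\<close> by auto
      have f: "(\<sigma> ^^ m) y = y" for m by (induction m) (auto simp: fy)
      have "c = (\<sigma> ^^ (p - j)) y" using j powp[of 0 1]
        by (simp add: funpow_add[symmetric, THEN fun_cong, unfolded o_def])
      then show False using f c(2) fy by simp
    qed
    have "finprod G f (Y - ?O) = finprod G f {c \<in> Y - ?O. \<sigma> c = c}"
    proof (rule less.hyps)
      show "card (Y - ?O) < card Y"
        using c(1) inO[of 0] less.prems(1) by (intro psubset_card_mono) auto
    qed (use less.prems sig in auto)
    moreover have "{c \<in> Y - ?O. \<sigma> c = c} = {c \<in> Y. \<sigma> c = c}" using nofix by auto
    moreover have "finprod G f ?O = \<one>"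
      using finprod_reindex[OF _ inj, of f] less.prems(5)[OF c] less.prems(4) pow by auto
    moreover have "finprod G f Y = finprod G f ?O \<otimes> finprod G f (Y - ?O)"
    proof -
      have "finprod G f (?O \<union> (Y - ?O)) = finprod G f ?O \<otimes> finprod G f (Y - ?O)"
        using O_X less.prems(1,4) by (intro finprod_Un_disjoint) auto
      moreover have "?O \<union> (Y - ?O) = Y" using O_X by (rule Diff_partition)
      ultimately show ?thesis by simp
    qed
    ultimately show ?thesis using less.prems(4) by (simp add: finprod_closed Pi_def)
  qed
qed

section \<open>Conjugation modulo a subgroup\<close>

lemma (in group) inv_mult_cancel:
  assumes "x \<in> carrier G" "y \<in> carrier G"
  shows "inv x \<otimes> (x \<otimes> y) = y" "x \<otimes> (inv x \<otimes> y) = y"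
  using assms by (simp_all flip: m_assoc)

lemma (in group) conj_pow:
  assumes "x \<in> carrier G" "r \<in> carrier G"
  shows "r \<otimes> x [^] (i::nat) \<otimes> inv r = (r \<otimes> x \<otimes> inv r) [^] i"
proof (induction i)
  case (Suc i)
  have "r \<otimes> x [^] Suc i \<otimes> inv r = (r \<otimes> x [^] i \<otimes> inv r) \<otimes> (r \<otimes> x \<otimes> inv r)"
    using assms by (simp add: m_assoc inv_mult_cancel)
  then show ?case using Suc by simp
qed (use assms in simp)

lemma (in group) powers_subgroup_prime:
  assumes "finite (carrier G)" "Factorial_Ring.prime p" "x \<in> carrier G" "x [^] p = \<one>" "x \<noteq> \<one>"
  shows "subgroup ((\<lambda>i::nat. x [^] i) ` {..<p}) G" "card ((\<lambda>i::nat. x [^] i) ` {..<p}) = p"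
proof -
  have "ord x = p" using assms
    by (metis One_nat_def ord_eq_1 pow_eq_id prime_nat_iff)
  have "generate G {x} = (\<lambda>i::nat. x [^] i) ` {..<p}"
    using generate_pow_nat[OF assms(3)] ord_elems_inf_carrier[OF assms(3)] \<open>ord x = p\<close> prime_gt_0_nat[OF assms(2)]
    by (auto simp: image_iff)
  then show "subgroup ((\<lambda>i::nat. x [^] i) ` {..<p}) G" "card ((\<lambda>i::nat. x [^] i) ` {..<p}) = p"
    using generate_is_subgroup[of "{x}"] generate_pow_card[OF assms(3)] \<open>ord x = p\<close> assms(3) by auto
qed

lemma (in group) finite_subgroupI:
  assumes "finite (carrier G)" "H \<subseteq> carrier G" "H \<noteq> {}"
    and "\<And>a b. a \<in> H \<Longrightarrow> b \<in> H \<Longrightarrow> a \<otimes> b \<in> H"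
  shows "subgroup H G"
proof (rule subgroupI)
  fix a assume a: "a \<in> H"
  then have ac: "a \<in> carrier G" using assms(2) by auto
  have pow: "a [^] Suc n \<in> H" for n by (induction n) (use a ac assms in auto)
  \<comment> \<open>The exponent \<open>2 * n + 1\<close> used below is
    \<open>2 * order G - 1\<close>: it yields the inverse and is positive even when
    \<open>order G\<close> is 1, as needed because only positive powers of \<open>a\<close> are
    known to lie in \<open>H\<close>.\<close>
  obtain n where n: "order G = Suc n" using assms(1) order_gt_0_iff_finite by (metis gr0_implies_Suc)
  have "a [^] (2 * n + 1) \<otimes> a = a [^] Suc (2 * n + 1)" by (rule nat_pow_Suc[symmetric])
  also have "Suc (2 * n + 1) = order G * 2" using n by simp
  also have "a [^] (order G * 2) = (a [^] order G) [^] (2::nat)" using ac by (simp add: nat_pow_pow)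
  also have "\<dots> = \<one>" using ac by (simp add: pow_order_eq_1)
  finally have "inv a = a [^] (2 * n + 1)" using ac by (metis inv_equality nat_pow_closed)
  then show "inv a \<in> H" using pow[of "2 * n"] by simp
qed (use assms in auto)

lemma (in group) rcosets_shift:
  assumes "H \<subseteq> carrier G" "c \<in> rcosets H" "x \<in> carrier G"
  shows "c #> x \<in> rcosets H"
proof -
  obtain a where "a \<in> carrier G" "c = H #> a" using assms(2) unfolding RCOSETS_def by blast
  then show ?thesis using assms rcosetsI[of H "a \<otimes> x"] by (simp add: coset_mult_assoc)
qed

lemma (in group) mem_r_coset_iff:
  assumes "M \<subseteq> carrier G" "a \<in> carrier G" "x \<in> carrier G"
  shows "x \<in> M #> a \<longleftrightarrow> x \<otimes> inv a \<in> M"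
proof
  assume "x \<otimes> inv a \<in> M"
  moreover have "x = (x \<otimes> inv a) \<otimes> a" using assms by (simp add: m_assoc)
  ultimately show "x \<in> M #> a" by (auto simp: r_coset_def)
next
  assume "x \<in> M #> a"
  then obtain m where "m \<in> M" "x = m \<otimes> a" by (auto simp: r_coset_def)
  moreover have "m \<otimes> a \<otimes> inv a = m" using assms calculation by (simp add: m_assoc subset_iff)
  ultimately show "x \<otimes> inv a \<in> M" by simp
qed

text \<open>This is how a count of fixed cosets produces elements that normalize
  \<open>M\<close>.\<close>

lemma (in group) r_coset_fixed_iff:
  assumes "subgroup M G" "t \<in> carrier G" "x \<in> carrier G"
  shows "(M #> t) #> x = M #> t \<longleftrightarrow> t \<otimes> x \<otimes> inv t \<in> M"
proof -
  interpret subgroup M G by fact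
  have "(M #> t) #> x = M #> (t \<otimes> x)" using assms by (simp add: coset_mult_assoc subset)
  also have "\<dots> = M #> t \<longleftrightarrow> t \<otimes> x \<in> M #> t"
    using assms rcos_self[of "t \<otimes> x" M] repr_independence[of "t \<otimes> x" M t] by auto
  also have "\<dots> \<longleftrightarrow> t \<otimes> x \<otimes> inv t \<in> M"
    using assms by (intro mem_r_coset_iff) (auto simp: subset)
  finally show ?thesis .
qed

text \<open>Arithmetic modulo \<open>M\<close> is done with cosets instead of a quotient group,
  because \<open>M\<close> is normalized by \<open>a\<close> but need not be normal in
  \<open>G\<close>, where the conjugating elements live.\<close>

lemma (in group) pow_mod_subgroup:
  assumes M: "subgroup M G" and a: "a \<in> carrier G" "\<And>m. m \<in> M \<Longrightarrow> a \<otimes> m \<otimes> inv a \<in> M"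
    and b: "b \<in> M #> a [^] (k::nat)"
  shows "b [^] (n::nat) \<in> M #> a [^] (k * n)"
proof (induction n)
  interpret M: subgroup M G by fact
  case 0
  show ?case by (simp add: M.subset)
next
  interpret M: subgroup M G by fact
  case (Suc n)
  obtain m m' where m: "m \<in> M" "b = m \<otimes> a [^] k" "m' \<in> M" "b [^] n = m' \<otimes> a [^] (k * n)"
    using b Suc by (auto simp: r_coset_def)
  have conj: "a [^] j \<otimes> m \<otimes> inv (a [^] j) \<in> M" for j :: nat
  proof (induction j)
    case (Suc j)
    have "a [^] Suc j \<otimes> m \<otimes> inv (a [^] Suc j) = a \<otimes> (a [^] j \<otimes> m \<otimes> inv (a [^] j)) \<otimes> inv a"
      using a m(1) by (simp only: nat_pow_Suc2) (simp add: inv_mult_group m_assoc)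
    then show ?case using a(2)[OF Suc] by simp
  qed (use m in simp)
  have "b [^] Suc n = (m' \<otimes> (a [^] (k * n) \<otimes> m \<otimes> inv (a [^] (k * n)))) \<otimes> a [^] (k * n + k)"
    using m a by (simp add: m_assoc nat_pow_mult[symmetric] inv_mult_cancel)
  then show ?case using conj[of "k * n"] m by (auto simp: r_coset_def add.commute)
qed

lemma (in group) pow_mem_imp_prime_dvd:
  assumes M: "subgroup M G" and a: "a \<in> carrier G" "a \<notin> M" "a [^] p \<in> M" and p: "Factorial_Ring.prime p"
    and n: "a [^] (n::nat) \<in> M"
  shows "p dvd n"
proof (rule ccontr)
  interpret M: subgroup M G by fact
  assume "\<not> p dvd n"
  then have "coprime n p" using p by (metis coprime_commute prime_imp_coprime)
  have pw: "b [^] (j::nat) \<in> M" if "b \<in> M" for b j by (induction j) (use that in auto)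
  have "n \<noteq> 0" using \<open>\<not> p dvd n\<close> by (metis dvd_0_right)
  then obtain u v where uv: "n * u = p * v + 1" using bezout_nat[of n p] \<open>coprime n p\<close> by auto
  have "(a [^] n) [^] u = (a [^] p) [^] v \<otimes> a" using a uv by (simp add: nat_pow_pow)
  then have "a = inv ((a [^] p) [^] v) \<otimes> (a [^] n) [^] u" using a by (simp add: inv_solve_left)
  then show False using pw[OF n] pw[OF a(3)] a(2) by (metis M.m_closed M.m_inv_closed)
qed

text \<open>Conjugation by \<open>r\<close> acts on the group of order \<open>p\<close> generated by \<open>a\<close> modulo \<open>M\<close>
  as an automorphism of order dividing both \<open>p - 1\<close> and \<open>|G|\<close>.\<close>
lemma (in group) conj_trivial_mod:
  assumes M: "subgroup M G" and a: "a \<in> carrier G" "\<And>m. m \<in> M \<Longrightarrow> a \<otimes> m \<otimes> inv a \<in> M"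
      "a \<notin> M" "a [^] p \<in> M"
    and p: "Factorial_Ring.prime p" "coprime (p - 1) (order G)" and fin: "finite (carrier G)"
    and r: "r \<in> carrier G" "\<And>m. m \<in> M \<Longrightarrow> r \<otimes> m \<otimes> inv r \<in> M" "r \<otimes> a \<otimes> inv r \<in> M #> a [^] (k::nat)"
  shows "r \<otimes> a \<otimes> inv r \<in> M #> a"
proof -
  interpret M: subgroup M G by fact
  let ?n = "order G"
  \<comment> \<open>Each further conjugation by \<open>r\<close> multiplies the exponent by
    \<open>k\<close>. Conjugation by \<open>r [^] ?n\<close> is trivial, which will force
    \<open>k ^ ?n\<close> to be 1 modulo \<open>p\<close>.\<close>
  have conj_iter: "r [^] j \<otimes> a \<otimes> inv (r [^] j) \<in> M #> a [^] (k ^ j)" for j :: nat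
  proof (induction j)
    case 0
    then show ?case using a by (auto simp: r_coset_def intro: bexI[of _ \<one>])
  next
    case (Suc j)
    obtain m where m: "m \<in> M" "r [^] j \<otimes> a \<otimes> inv (r [^] j) = m \<otimes> a [^] (k ^ j)"
      using Suc by (auto simp: r_coset_def)
    have "r [^] Suc j \<otimes> a \<otimes> inv (r [^] Suc j) = r \<otimes> (r [^] j \<otimes> a \<otimes> inv (r [^] j)) \<otimes> inv r"
      using a(1) r(1) by (simp only: nat_pow_Suc2) (simp add: inv_mult_group m_assoc)
    also have "\<dots> = (r \<otimes> m \<otimes> inv r) \<otimes> (r \<otimes> a [^] (k ^ j) \<otimes> inv r)"
      using m a(1) r(1) by (simp add: m_assoc inv_mult_cancel)
    also have "r \<otimes> a [^] (k ^ j) \<otimes> inv r = (r \<otimes> a \<otimes> inv r) [^] (k ^ j)"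
    by (rule conj_pow[OF a(1) r(1)])
    finally have eq: "r [^] Suc j \<otimes> a \<otimes> inv (r [^] Suc j) = (r \<otimes> m \<otimes> inv r) \<otimes> (r \<otimes> a \<otimes> inv r) [^] (k ^ j)" .
    obtain m' where m': "m' \<in> M" "(r \<otimes> a \<otimes> inv r) [^] (k ^ j) = m' \<otimes> a [^] (k * k ^ j)"
      using pow_mod_subgroup[OF M a(1,2) r(3)] by (auto simp: r_coset_def)
    have "r [^] Suc j \<otimes> a \<otimes> inv (r [^] Suc j) = ((r \<otimes> m \<otimes> inv r) \<otimes> m') \<otimes> a [^] (k ^ Suc j)"
      using eq m' a(1) r(2)[OF m(1)] by (simp add: m_assoc)
    then show ?case using r(2)[OF m(1)] m'(1) by (auto simp: r_coset_def)
  qed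
  \<comment> \<open>Excluding \<open>k = 0\<close> makes the natural-number subtraction in
    \<open>k ^ ?n - 1\<close> genuine.\<close>
  have k0: "k \<noteq> 0"
  proof
    assume "k = 0"
    then have "r \<otimes> a \<otimes> inv r \<in> M" using r(3) by (simp add: M.subset)
    have "r [^] ?n \<otimes> a \<otimes> inv (r [^] ?n) \<in> M #> a [^] (k ^ ?n)" by (rule conj_iter)
    moreover have "?n > 0" using fin by (simp add: order_gt_0_iff_finite)
    ultimately show False using \<open>k = 0\<close> a r(1) by (simp add: pow_order_eq_1 power_0_left M.subset)
  qed
  have "a \<in> M #> a [^] (k ^ ?n)" using conj_iter[of ?n] a(1) r(1) by (simp add: pow_order_eq_1)
  then obtain m where m: "m \<in> M" "a = m \<otimes> a [^] (k ^ ?n)" by (auto simp: r_coset_def)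
  have "a [^] (k ^ ?n - 1) = inv m"
  proof -
    have "a [^] (k ^ ?n) = a [^] (k ^ ?n - 1) \<otimes> a"
      using k0 by (metis Suc_diff_1 nat_pow_Suc neq0_conv zero_less_power)
    then have "\<one> \<otimes> a = (m \<otimes> a [^] (k ^ ?n - 1)) \<otimes> a" using m a(1) by (simp add: m_assoc)
    then have "m \<otimes> a [^] (k ^ ?n - 1) = \<one>" using m(1) a(1) by (metis M.mem_carrier m_closed nat_pow_closed one_closed right_cancel)
    then show ?thesis using m(1) a(1) by (metis M.mem_carrier inv_equality inv_inv inv_comm nat_pow_closed)
  qed
  then have "p dvd k ^ ?n - 1"
    using pow_mem_imp_prime_dvd[OF M a(1,3,4) p(1)] m(1) by simp
  then have kn: "[k ^ ?n = 1] (mod p)"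
    using k0 by (metis (no_types) cong_altdef_nat cong_sym One_nat_def Suc_leI zero_less_power neq0_conv)
  have "\<not> p dvd k"
  proof
    assume "p dvd k"
    moreover have "?n > 0" using fin by (simp add: order_gt_0_iff_finite)
    ultimately have "[k ^ ?n = 0] (mod p)" 
      using dvd_trans[OF _ dvd_power[of ?n k]] by (simp add: cong_0_iff)
    with kn show False using p(1) by (metis cong_0_1_nat cong_sym cong_trans not_prime_1)
  qed
  then have kp: "[k ^ (p - 1) = 1] (mod p)" using fermat_theorem p(1) by blast
  have "?n \<noteq> 0" using fin order_gt_0_iff_finite by auto
  then obtain u v where uv: "?n * u = (p - 1) * v + 1"
    using bezout_nat[of ?n "p - 1"] p(2) by (auto simp: coprime_commute)
  have "[(k ^ ?n) ^ u = 1 ^ u] (mod p)" by (rule cong_pow[OF kn])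
  moreover have "[(k ^ (p - 1)) ^ v * k = 1 ^ v * k] (mod p)" by (intro cong_mult cong_pow kp cong_refl)
  moreover have "(k ^ ?n) ^ u = (k ^ (p - 1)) ^ v * k"
    using uv by (simp flip: power_mult power_Suc2)
  ultimately have k1: "[k = 1] (mod p)" by (metis cong_sym cong_trans mult_1 power_one)
  then obtain q where q: "k = 1 + p * q" using k0 by (metis cong_le_nat cong_sym Suc_leI One_nat_def neq0_conv mult.commute add.commute)
  have pw: "b [^] (j::nat) \<in> M" if "b \<in> M" for b j by (induction j) (use that in auto)
  have "a [^] k = (a [^] p) [^] q \<otimes> a" using q a(1) by (simp add: nat_pow_pow)
  then have "M #> a [^] k = M #> a" using pw[OF a(4)] a(1)
    by (metis coset_join2 coset_mult_assoc M.subset M M.mem_carrier)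
  then show ?thesis using r(3) by simp
qed

section \<open>Maximal subgroups of \<open>p\<close>-groups\<close>

text \<open>Let \<open>M\<close> act on its own cosets. Their number is a multiple of
  \<open>p\<close>, hence so is the number of fixed ones; \<open>M\<close> itself is fixed, so some
  other coset \<open>M #> t\<close> is too. Then \<open>t\<close> normalizes \<open>M\<close>
  without lying in it, and maximality makes the normalizer everything.\<close>

lemma (in group) maximal_subgroup_p_group_normal:
  assumes G: "order G = p ^ k" "Factorial_Ring.prime p" and M: "maximal_subgroup M G"
  shows "M \<lhd> G"
proof -
  have sub: "subgroup M G" and ne: "M \<noteq> carrier G"
    and max: "\<And>K. subgroup K G \<Longrightarrow> M \<subseteq> K \<Longrightarrow> K = M \<or> K = carrier G"
    using M by (auto simp: maximal_subgroup_def)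
  interpret M: subgroup M G by (rule sub)
  have fin: "finite (carrier G)"
    using G order_gt_0_iff_finite by (metis prime_gt_0_nat zero_less_power)
  let ?F = "{c \<in> rcosets M. \<forall>s \<in> M. c #> s = c}"
  have lag: "card (rcosets M) * card M = p ^ k" using lagrange[OF sub] G by simp
  obtain j where j: "card M = p ^ j" using lag G(2) by (metis divides_primepow_nat dvd_triv_right)
  have "card (rcosets M) \<noteq> 1"
  proof
    assume "card (rcosets M) = 1"
    then have "card M = card (carrier G)" using lag G by (simp add: order_def)
    then show False using ne card_subset_eq[OF fin M.subset] by simp
  qed
  then have "p dvd card (rcosets M)"
    using lag G(2) by (metis (no_types, lifting) divides_primepow_nat dvd_power dvd_triv_left gr_zeroI power_0)
  moreover have cong: "[card (rcosets M) = card ?F] (mod p)"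
  proof (rule card_cong_fixed_r_cosets[OF sub j G(2)])
    show "finite (rcosets M)" using fin sub by (simp add: rcosets_finite rcosets_part_G RCOSETS_def)
    show "rcosets M \<subseteq> Pow (carrier G)" by (rule rcosets_subset_PowG[OF sub])
    show "c #> s \<in> rcosets M" if "c \<in> rcosets M" "s \<in> M" for c s
      using that M.subset by (simp add: rcosets_shift)
  qed
  ultimately have pF: "p dvd card ?F" using cong_dvd_iff[OF cong] by blast
  have "M #> \<one> \<in> ?F"
    using r_coset_fixed_iff[OF sub one_closed] rcosetsI[OF M.subset one_closed] by simp
  moreover have "finite ?F" using fin sub by (simp add: RCOSETS_def)
  ultimately have "card ?F \<noteq> 0" using card_0_eq by blast
  then have "p \<le> card ?F" by (intro dvd_imp_le[OF pF]) blast
  then have "card ?F \<ge> 2" using prime_ge_2_nat[OF G(2)] by linarith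
  then have "\<not> ?F \<subseteq> {M #> \<one>}" using card_mono[of "{M #> \<one>}" ?F] by auto
  then obtain c where c: "c \<in> ?F" "c \<noteq> M" by (auto simp: M.subset)
  then obtain t where t: "t \<in> carrier G" "c = M #> t" by (auto simp: RCOSETS_def)
  have "t \<notin> M" using c(2) t coset_join2[OF t(1) sub] by auto
  define N where "N = {t \<in> carrier G. \<forall>s \<in> M. t \<otimes> s \<otimes> inv t \<in> M}"
  have "t \<in> N" using c(1) t r_coset_fixed_iff[OF sub t(1)] M.subset by (auto simp: N_def)
  have "subgroup N G"
  proof (rule finite_subgroupI[OF fin])
    fix a b assume ab: "a \<in> N" "b \<in> N"
    have "a \<otimes> b \<otimes> s \<otimes> inv (a \<otimes> b) \<in> M" if s: "s \<in> M" for s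
    proof -
      have "a \<otimes> (b \<otimes> s \<otimes> inv b) \<otimes> inv a \<in> M" using ab s by (auto simp: N_def)
      then show ?thesis using ab s by (simp add: N_def m_assoc inv_mult_group)
    qed
    then show "a \<otimes> b \<in> N" using ab by (auto simp: N_def)
  qed (use \<open>t \<in> N\<close> in \<open>auto simp: N_def\<close>)
  moreover have "M \<subseteq> N" by (auto simp: N_def)
  ultimately have "N = carrier G" using max \<open>t \<in> N\<close> \<open>t \<notin> M\<close> by blast
  then show ?thesis using sub by (auto simp: normal_inv_iff N_def)
qed

text \<open>The union of the cosets \<open>M #> a [^] i\<close> is closed under products by
  normality, and it properly contains \<open>M\<close>.\<close>

lemma (in group) maximal_normal_subgroup_cover:
  assumes "finite (carrier G)" and M: "maximal_subgroup M G" "M \<lhd> G"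
    and a: "a \<in> carrier G" "a \<notin> M" and x: "x \<in> carrier G"
  shows "\<exists>i::nat. x \<in> M #> a [^] i"
proof -
  interpret M: normal M G by (rule M)
  define U where "U = {x \<in> carrier G. \<exists>i::nat. x \<in> M #> a [^] i}"
  have one: "M \<subseteq> U" by (auto simp: U_def M.subset intro!: exI[of _ 0])
  have "subgroup U G"
  proof (rule finite_subgroupI[OF assms(1)])
    fix y z assume yz: "y \<in> U" "z \<in> U"
    then obtain i j m m' where m: "m \<in> M" "m' \<in> M" "y = m \<otimes> a [^] (i::nat)" "z = m' \<otimes> a [^] (j::nat)"
      by (auto simp: U_def r_coset_def)
    have "y \<otimes> z = (m \<otimes> (a [^] i \<otimes> m' \<otimes> inv (a [^] i))) \<otimes> a [^] (i + j)"
      using m a by (simp add: m_assoc inv_mult_cancel flip: nat_pow_mult)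
    moreover have "m \<otimes> (a [^] i \<otimes> m' \<otimes> inv (a [^] i)) \<in> M"
      using m a by (simp add: M.inv_op_closed2)
    ultimately have "y \<otimes> z \<in> M #> a [^] (i + j)" by (auto simp: r_coset_def)
    then show "y \<otimes> z \<in> U" using yz by (auto simp: U_def)
  next
    show "U \<noteq> {}" using one M.one_closed by blast
  qed (auto simp: U_def)
  moreover have "a \<in> U" using a M.one_closed by (auto simp: U_def r_coset_def intro!: exI[of _ 1] bexI[of _ \<one>])
  ultimately have "U = carrier G" using M(1) one a(2) by (auto simp: maximal_subgroup_def)
  then show ?thesis using x by (auto simp: U_def)
qed

text \<open>If \<open>a [^] p\<close> were outside \<open>M\<close>, its powers would meet every
  coset, so \<open>a\<close> would agree with some \<open>a [^] (p * i)\<close> modulo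
  \<open>M\<close>. Iterating \<open>k\<close> times makes the exponent a multiple of
  \<open>p ^ k\<close>, the group order, and puts \<open>a\<close> into \<open>M\<close>.\<close>

lemma (in group) maximal_subgroup_p_group_pow:
  assumes G: "order G = p ^ k" "Factorial_Ring.prime p" and M: "maximal_subgroup M G"
    and a: "a \<in> carrier G"
  shows "a [^] p \<in> M"
proof (cases "a \<in> M")
  case True
  interpret subgroup M G using M by (simp add: maximal_subgroup_def)
  have "a [^] (j::nat) \<in> M" for j by (induction j) (use True in auto)
  then show ?thesis .
next
  case False
  interpret M: normal M G by (rule maximal_subgroup_p_group_normal[OF G M])
  have fin: "finite (carrier G)"
    using G order_gt_0_iff_finite by (metis prime_gt_0_nat zero_less_power)
  show ?thesis
  proof (rule ccontr)
    assume "a [^] p \<notin> M"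
    then obtain i where "a \<in> M #> (a [^] p) [^] (i::nat)"
      using maximal_normal_subgroup_cover[OF fin M M.normal_axioms, of "a [^] p" a] a by auto
    then have i: "a \<in> M #> a [^] (p * i)" using a by (simp add: nat_pow_pow)
    have "M #> a = M #> a [^] ((p * i) ^ n)" for n
    proof (induction n)
      case (Suc n)
      have "a [^] ((p * i) ^ n) \<in> M #> a [^] (p * i * (p * i) ^ n)"
        using pow_mod_subgroup[OF M.subgroup_axioms a _ i] M.inv_op_closed2 a by blast
      then show ?case using Suc repr_independence[OF _ _ M.subgroup_axioms] a by simp
    qed (use a in simp)
    from this[of k] have "M #> a = M #> a [^] (p ^ k * i ^ k)" by (simp add: power_mult_distrib)
    also have "a [^] (p ^ k * i ^ k) = \<one>" using a G pow_order_eq_1[OF a] by (simp flip: nat_pow_pow)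
    finally show False using False a rcos_self[OF a M.subgroup_axioms] M.subset by simp
  qed
qed

lemma (in group) exists_maximal_subgroup:
  assumes "finite (carrier G)" "subgroup H G" "H \<noteq> carrier G"
  obtains M where "maximal_subgroup M G" "H \<subseteq> M"
proof -
  let ?P = "\<lambda>M. subgroup M G \<and> M \<noteq> carrier G \<and> H \<subseteq> M"
  have "\<forall>M. ?P M \<longrightarrow> card M < Suc (card (carrier G))"
    using assms(1) by (auto simp: less_Suc_eq_le intro!: card_mono dest: subgroup.subset)
  then obtain M where M: "?P M" "\<And>K. ?P K \<Longrightarrow> card K \<le> card M"
    using ex_has_greatest_nat[of ?P H card "Suc (card (carrier G))"] assms by auto
  have "K = M \<or> K = carrier G" if K: "subgroup K G" "M \<subseteq> K" for K
  proof (rule disjCI)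
    assume "K \<noteq> carrier G"
    then have "card K \<le> card M" using M(1) K by (intro M(2)) auto
    moreover have "finite K" using K(1) assms(1) finite_subset subgroup.subset by blast
    ultimately show "K = M" using K(2) card_seteq by blast
  qed
  then show thesis using M(1) that by (auto simp: maximal_subgroup_def)
qed

section \<open>The transfer\<close>

text \<open>The target is kept abstract because the transfer is used twice: into an abelian quotient
  of \<open>S\<close>, and into an abelian \<open>Q\<close> with the identity as
  \<open>\<theta>\<close>.\<close>

locale transfer = G: group G + A: comm_group A for G (structure) and A (structure) +
  fixes S and \<theta>
  assumes fin: "finite (carrier G)" and sub: "subgroup S G" and hom: "\<theta> \<in> hom (G\<lparr>carrier := S\<rparr>) A"
begin

sublocale S: subgroup S G by (rule sub)

sublocale \<theta>: group_hom "G\<lparr>carrier := S\<rparr>" A \<theta>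
  using hom S.subgroup_is_group[OF G.is_group] A.is_group
  by (simp add: group_hom_def group_hom_axioms_def)

lemma \<theta>_closed [simp]: "s \<in> S \<Longrightarrow> \<theta> s \<in> carrier A"
  using \<theta>.hom_closed by simp

lemma \<theta>_mult: "s \<in> S \<Longrightarrow> t \<in> S \<Longrightarrow> \<theta> (s \<otimes> t) = \<theta> s \<otimes>\<^bsub>A\<^esub> \<theta> t"
  using \<theta>.hom_mult by simp

lemma \<theta>_one [simp]: "\<theta> \<one> = \<one>\<^bsub>A\<^esub>"
  using \<theta>.hom_one by simp

lemma \<theta>_conj: "u \<in> S \<Longrightarrow> s \<in> S \<Longrightarrow> \<theta> (u \<otimes> s \<otimes> inv u) = \<theta> s"
proof -
  assume us: "u \<in> S" "s \<in> S"
  have "\<theta> (u \<otimes> s \<otimes> inv u) = \<theta> s \<otimes>\<^bsub>A\<^esub> (\<theta> u \<otimes>\<^bsub>A\<^esub> \<theta> (inv u))"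
    using us by (simp add: \<theta>_mult A.m_ac)
  also have "\<theta> u \<otimes>\<^bsub>A\<^esub> \<theta> (inv u) = \<one>\<^bsub>A\<^esub>"
    using us by (simp flip: \<theta>_mult)
  finally show ?thesis using us by simp
qed

definition rep :: "'a set \<Rightarrow> 'a" where "rep c = (SOME t. t \<in> c)"

text \<open>The transfer with respect to the transversal chosen by \<open>rep\<close>. Independence
  of that choice is needed at fixed cosets, where \<open>\<theta>_conj_rep\<close> supplies
  it.\<close>

definition V :: "'a \<Rightarrow> 'c"
  where "V x = (\<Otimes>\<^bsub>A\<^esub>c\<in>rcosets S. \<theta> (rep c \<otimes> x \<otimes> inv (rep (c #> x))))"

lemma finite_rcosets [simp]: "finite (rcosets S)"
  using fin by (simp add: RCOSETS_def)

lemma rcoset_eq: "c \<in> rcosets S \<Longrightarrow> t \<in> c \<Longrightarrow> t \<in> carrier G \<and> c = S #> t"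
proof -
  assume c: "c \<in> rcosets S" "t \<in> c"
  then obtain a where a: "a \<in> carrier G" "c = S #> a" unfolding RCOSETS_def by blast
  then show ?thesis using G.repr_independence[OF _ a(1) sub, of t] S.rcosets_carrier[OF G.is_group c(1)] c by auto
qed

lemma rep_in: "c \<in> rcosets S \<Longrightarrow> rep c \<in> c"
proof -
  assume "c \<in> rcosets S"
  then have "\<exists>t. t \<in> c" using G.rcos_self[OF _ sub] unfolding RCOSETS_def by blast
  then show ?thesis unfolding rep_def by (rule someI_ex)
qed

lemma rep_closed [simp]: "c \<in> rcosets S \<Longrightarrow> rep c \<in> carrier G"
  using rcoset_eq rep_in by blast

lemma shift [simp]: "c \<in> rcosets S \<Longrightarrow> x \<in> carrier G \<Longrightarrow> c #> x \<in> rcosets S"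
  by (rule G.rcosets_shift[OF S.subset])

lemma rcoset_subset: "c \<in> rcosets S \<Longrightarrow> c \<subseteq> carrier G"
  by (rule S.rcosets_carrier[OF G.is_group])

lemma mult_rep_inv_in: 
  assumes "c \<in> rcosets S" "x \<in> carrier G" "t \<in> c" "u \<in> c #> x"
  shows "t \<otimes> x \<otimes> inv u \<in> S"
proof -
  have t: "t \<in> carrier G" "c = S #> t" using rcoset_eq assms by auto
  then have "c #> x = S #> (t \<otimes> x)" using assms S.subset by (simp add: G.coset_mult_assoc)
  then obtain s where s: "s \<in> S" "u = s \<otimes> (t \<otimes> x)" using assms by (auto simp: r_coset_def)
  then have "t \<otimes> x \<otimes> inv u = inv s"
    using t assms by (simp add: G.inv_mult_group G.m_assoc G.inv_mult_cancel)
  then show ?thesis using s by simp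
qed

lemma factor_in [simp]:
  assumes "c \<in> rcosets S" "x \<in> carrier G"
  shows "rep c \<otimes> x \<otimes> inv (rep (c #> x)) \<in> S"
  using assms by (simp add: mult_rep_inv_in rep_in)

text \<open>A cocycle identity: the representative of the intermediate coset \<open>c #> x\<close>
  is inserted and cancels.\<close>

lemma factor_mult:
  assumes c: "c \<in> rcosets S" and xy: "x \<in> carrier G" "y \<in> carrier G"
  shows "\<theta> (rep c \<otimes> (x \<otimes> y) \<otimes> inv (rep (c #> (x \<otimes> y)))) =
    \<theta> (rep c \<otimes> x \<otimes> inv (rep (c #> x))) \<otimes>\<^bsub>A\<^esub>
    \<theta> (rep (c #> x) \<otimes> y \<otimes> inv (rep (c #> x #> y)))"
proof -
  have cc: "c #> (x \<otimes> y) = c #> x #> y"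
    using G.coset_mult_assoc[OF rcoset_subset[OF c] xy] by simp
  have "rep c \<otimes> (x \<otimes> y) \<otimes> inv (rep (c #> x #> y)) =
    (rep c \<otimes> x \<otimes> inv (rep (c #> x))) \<otimes>
    (rep (c #> x) \<otimes> y \<otimes> inv (rep (c #> x #> y)))"
    using c xy by (simp add: G.m_assoc G.inv_mult_cancel)
  then show ?thesis using c xy by (simp only: cc) (simp add: \<theta>_mult del: S.m_closed)
qed

text \<open>The cocycle identity splits the product in two, and \<open>c \<mapsto> c #> x\<close>
  permutes the cosets, so the shifted half is again a transfer.\<close>

lemma V_hom: "V \<in> hom G A"
proof (rule homI)
  fix x assume "x \<in> carrier G"
  then show "V x \<in> carrier A" unfolding V_def by (intro A.finprod_closed) auto
next
  fix x y assume xy: "x \<in> carrier G" "y \<in> carrier G"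
  let ?R = "rcosets S"
  let ?f = "\<lambda>x c. \<theta> (rep c \<otimes> x \<otimes> inv (rep (c #> x)))"
  have "V (x \<otimes> y) = (\<Otimes>\<^bsub>A\<^esub>c\<in>?R. ?f x c \<otimes>\<^bsub>A\<^esub> ?f y (c #> x))"
    unfolding V_def using xy by (intro A.finprod_cong') (auto simp: factor_mult)
  also have "\<dots> = V x \<otimes>\<^bsub>A\<^esub> (\<Otimes>\<^bsub>A\<^esub>c\<in>?R. ?f y (c #> x))"
    unfolding V_def using xy by (intro A.finprod_multf) auto
  also have "(\<Otimes>\<^bsub>A\<^esub>c\<in>?R. ?f y (c #> x)) = V y"
  proof -
    have inj: "inj_on (\<lambda>c. c #> x) ?R"
      by (rule inj_onI) (rule G.r_coset_cancel[OF rcoset_subset rcoset_subset xy(1)])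
    have im: "(\<lambda>c. c #> x) ` ?R = ?R"
      using inj xy by (intro endo_inj_surj) auto
    show ?thesis unfolding V_def
      using A.finprod_reindex[OF _ inj, of "?f y"] xy by (simp add: im Pi_def)
  qed
  finally show "V (x \<otimes> y) = V x \<otimes>\<^bsub>A\<^esub> V y" .
qed

text \<open>At a coset fixed by \<open>x\<close> the factor is a conjugate of \<open>x\<close>.
  Another representative differs by an element of \<open>S\<close>, and conjugation inside
  \<open>S\<close> is invisible in the abelian group \<open>A\<close>.\<close>

lemma \<theta>_conj_rep:
  assumes c: "c \<in> rcosets S" and x: "x \<in> carrier G" "c #> x = c" and t: "t \<in> c"
  shows "t \<otimes> x \<otimes> inv t \<in> S"
    "\<theta> (rep c \<otimes> x \<otimes> inv (rep c)) = \<theta> (t \<otimes> x \<otimes> inv t)"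
proof -
  show tS: "t \<otimes> x \<otimes> inv t \<in> S"
    using mult_rep_inv_in[OF c x(1) t, of t] x t by simp
  obtain s where s: "s \<in> S" "rep c = s \<otimes> t"
    using rcoset_eq[OF c t] rep_in[OF c] by (auto simp: r_coset_def)
  have "rep c \<otimes> x \<otimes> inv (rep c) = s \<otimes> (t \<otimes> x \<otimes> inv t) \<otimes> inv s"
    using s x rcoset_eq[OF c t] by (simp add: G.inv_mult_group G.m_assoc)
  then show "\<theta> (rep c \<otimes> x \<otimes> inv (rep c)) = \<theta> (t \<otimes> x \<otimes> inv t)"
    using s tS by (simp add: \<theta>_conj)
qed

text \<open>Along a cycle of \<open>x\<close> the factors telescope to the factor of
  \<open>x [^] p\<close>, which is trivial. So only the fixed cosets survive.\<close>

lemma V_order_p: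
  fixes p :: nat
  assumes p: "Factorial_Ring.prime p" and x: "x \<in> carrier G" "x [^] p = \<one>"
  shows "V x = (\<Otimes>\<^bsub>A\<^esub>c\<in>{c \<in> rcosets S. c #> x = c}. \<theta> (rep c \<otimes> x \<otimes> inv (rep c)))"
proof -
  let ?R = "rcosets S"
  let ?f = "\<lambda>x c. \<theta> (rep c \<otimes> x \<otimes> inv (rep (c #> x)))"
  have iter: "((\<lambda>c. c #> x) ^^ j) c = c #> x [^] j" if "c \<in> ?R" for c j
    by (induction j) (use x that rcoset_subset in \<open>auto simp: G.coset_mult_assoc\<close>)
  have tele: "(\<Otimes>\<^bsub>A\<^esub>j\<in>{..<n}. ?f x (c #> x [^] j)) = ?f (x [^] n) c" if "c \<in> ?R" for c and n :: nat
  proof (induction n)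
    case 0
    then show ?case using that rcoset_subset by simp
  next
    case (Suc n)
    have "(\<Otimes>\<^bsub>A\<^esub>j\<in>{..<Suc n}. ?f x (c #> x [^] j)) =
        ?f x (c #> x [^] n) \<otimes>\<^bsub>A\<^esub> ?f (x [^] n) c"
      using that x Suc by (simp add: lessThan_Suc Pi_def)
    also have "\<dots> = ?f (x [^] n) c \<otimes>\<^bsub>A\<^esub> ?f x (c #> x [^] n)"
      using that x by (intro A.m_comm) auto
    also have "\<dots> = ?f (x [^] Suc n) c"
      using factor_mult[OF that, of "x [^] n" x] x by simp
    finally show ?case .
  qed
  have "V x = finprod A (?f x) {c \<in> ?R. c #> x = c}"
    unfolding V_def
  proof (rule A.finprod_prime_cycles[OF p])
    fix c assume c: "c \<in> ?R"
    show "((\<lambda>c. c #> x) ^^ p) c = c" using iter[OF c] x rcoset_subset[OF c] by simp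
    show "(\<Otimes>\<^bsub>A\<^esub>j\<in>{..<p}. ?f x (((\<lambda>c. c #> x) ^^ j) c)) = \<one>\<^bsub>A\<^esub>"
      using tele[OF c, of p] c x rcoset_subset[OF c] by (simp add: iter)
  qed (use x in auto)
  also have "\<dots> = (\<Otimes>\<^bsub>A\<^esub>c\<in>{c \<in> ?R. c #> x = c}. \<theta> (rep c \<otimes> x \<otimes> inv (rep c)))"
    using x by (intro A.finprod_cong') (auto intro!: \<theta>_closed \<theta>_conj_rep rep_in)
  finally show ?thesis .
qed

end

section \<open>Normal complements\<close>

lemma (in group) cauchy:
  assumes fin: "finite (carrier G)" and p: "Factorial_Ring.prime p" "p dvd order G"
  obtains x where "x \<in> carrier G" "x \<noteq> \<one>" "x [^] p = \<one>"
proof -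
  \<comment> \<open>Sylow's theorem is applied to the power \<open>p ^ 1\<close>, with the remaining
    factor \<open>m\<close> arbitrary, to get a subgroup of order exactly \<open>p\<close>.\<close>
  obtain m where "order G = p ^ 1 * m" using p(2) by auto
  then obtain H where H: "subgroup H G" "card H = p"
    using sylow_thm[OF p(1) is_group _ fin] by (metis power_one_right)
  interpret H: subgroup H G by (rule H)
  interpret HG: group "G\<lparr>carrier := H\<rparr>" by (rule H.subgroup_is_group[OF is_group])
  have "\<not> H \<subseteq> {\<one>}"
    using H(2) prime_ge_2_nat[OF p(1)] card_mono[of "{\<one>}" H] by auto
  then obtain x where x: "x \<in> H" "x \<noteq> \<one>" by auto
  have "x [^] p = \<one>"
    using HG.pow_order_eq_1[of x] x H(2) by (simp add: order_def nat_pow_consistent[symmetric])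
  then show thesis using that[of x] x by simp
qed

lemma (in group) p_nilpotentI:
  assumes "N \<lhd> G" "\<not> p dvd card N" "order G = p ^ k * card N"
  shows "p_nilpotent p G"
proof -
  have "card (rcosets N) * card N = p ^ k * card N"
    using lagrange[OF normal_imp_subgroup[OF assms(1)]] assms(3) by simp
  moreover have "card N \<noteq> 0" using assms(2) by (metis dvd_0_right)
  ultimately have "card (rcosets N) = p ^ k" by simp
  then show ?thesis using assms by (auto simp: p_nilpotent_def order_def FactGroup_def)
qed

text \<open>The normal \<open>p\<close>-complement of \<open>K\<close> consists of the \<open>x \<in> K\<close> with \<open>x\<^sup>n = 1\<close>, where \<open>n\<close> is its
  order, so it is characteristic in \<open>K\<close>.\<close>
lemma (in group) p_nilpotent_extension:
  assumes p: "Factorial_Ring.prime p"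
    and K: "K \<lhd> G" "order G = p ^ a * card K"
    and N: "N \<lhd> (G\<lparr>carrier := K\<rparr>)" "\<not> p dvd card N" "card K = p ^ b * card N"
  shows "p_nilpotent p G"
proof -
  let ?K = "G\<lparr>carrier := K\<rparr>"
  interpret K: normal K G by (rule K)
  interpret KG: group ?K by (rule K.subgroup_is_group[OF is_group])
  interpret N: normal N ?K by (rule N)
  let ?n = "card N"
  have NG: "subgroup N G" using incl_subgroup[OF K.subgroup_axioms N.subgroup_axioms] .
  interpret NN: subgroup N G by (rule NG)
  interpret F: group "?K Mod N" by (rule N.factorgroup_is_group)
  interpret NgG: group "G\<lparr>carrier := N\<rparr>" by (rule NN.subgroup_is_group[OF is_group])
  have n0: "?n \<noteq> 0" using N(2) by (metis dvd_0_right)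
  have "card (rcosets\<^bsub>?K\<^esub> N) * ?n = p ^ b * ?n"
    using KG.lagrange[OF N.subgroup_axioms] N(3) by (simp add: order_def)
  then have oF: "order (?K Mod N) = p ^ b" using n0 by (simp add: order_def FactGroup_def)
  have "x \<in> N" if x: "x \<in> K" "x [^] ?n = \<one>" for x
  proof -
    have "N #> x \<in> carrier (?K Mod N)" using x by (auto simp: carrier_FactGroup)
    then have "(N #> x) [^]\<^bsub>?K Mod N\<^esub> p ^ b = N" using F.pow_order_eq_1 oF by fastforce
    moreover have "(N #> x) [^]\<^bsub>?K Mod N\<^esub> p ^ b = N #> x [^] (p ^ b)"
      using N.FactGroup_pow[of x "p ^ b"] x by (simp add: nat_pow_consistent[symmetric])
    ultimately have pb: "x [^] (p ^ b) \<in> N"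
      using rcos_self[of "x [^] (p ^ b)" N] NG x by simp
    \<comment> \<open>Bezout writes the inverse of \<open>x\<close> as a power of
      \<open>x [^] (p ^ b)\<close>, which lies in \<open>N\<close>.\<close>
    have "coprime ?n (p ^ b)" using p N(2) by (metis coprime_commute coprime_power_right_iff prime_imp_coprime)
    then obtain u v where uv: "?n * u = p ^ b * v + 1" using bezout_nat[of ?n "p ^ b"] n0 by auto
    have "(x [^] ?n) [^] u = (x [^] (p ^ b)) [^] v \<otimes> x" using x(1) uv by (simp add: nat_pow_pow)
    then have "(x [^] (p ^ b)) [^] v \<otimes> x = \<one>" using x(2) by simp
    then have "inv x = (x [^] (p ^ b)) [^] v" using x(1) by (intro inv_equality) auto
    moreover have "(x [^] (p ^ b)) [^] (v::nat) \<in> N" by (induction v) (use pb in auto)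
    ultimately have "inv x \<in> N" by simp
    then show ?thesis using NN.m_inv_closed x(1) by fastforce
  qed
  moreover have "x [^] ?n = \<one>" if "x \<in> N" for x
    using NgG.pow_order_eq_1[of x] that by (simp add: order_def nat_pow_consistent[symmetric])
  moreover have "N \<subseteq> K" using N.subset by simp
  ultimately have Neq: "N = {x \<in> K. x [^] ?n = \<one>}" by auto
  have "N \<lhd> G"
    unfolding normal_inv_iff
  proof (intro conjI ballI NG)
    fix g x assume gx: "g \<in> carrier G" "x \<in> N"
    then have "x \<in> K" "x [^] ?n = \<one>" "x \<in> carrier G" using Neq by auto
    then have "g \<otimes> x \<otimes> inv g \<in> K" "(g \<otimes> x \<otimes> inv g) [^] ?n = \<one>"
      using gx K.inv_op_closed2 by (simp_all flip: conj_pow)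
    then show "g \<otimes> x \<otimes> inv g \<in> N" using Neq by blast
  qed
  moreover have "order G = p ^ (a + b) * ?n" using K N by (simp add: power_add)
  ultimately show ?thesis using p_nilpotentI N(2) by blast
qed

lemma (in group) fixed_r_coset_pow:
  assumes "c \<subseteq> carrier G" "x \<in> carrier G" "c #> x = c"
  shows "c #> x [^] (i::nat) = c"
  by (induction i) (use assms in \<open>simp_all flip: coset_mult_assoc\<close>)

text \<open>An element \<open>w\<close> of order \<open>p\<close> in the kernel need not lie in
  \<open>Q\<close>. It fixes a number of cosets prime to \<open>p\<close>, in particular at least
  one, and a fixed coset conjugates \<open>w\<close> to some \<open>z\<close> in \<open>Q\<close>.
  By \<open>few\<close> the powers of \<open>z\<close> are all the solutions of
  \<open>x^p = 1\<close> in \<open>Q\<close>, so every fixed coset contributes the same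
  \<open>z\<close>.\<close>

lemma (in group) normal_complement_abelian:
  fixes p :: nat
  assumes fin: "finite (carrier G)" and p: "Factorial_Ring.prime p" "coprime (p - 1) (order G)"
    and Q: "subgroup Q G" "card Q = p ^ k" "\<not> p dvd card (rcosets Q)"
    and comm: "\<And>x y. x \<in> Q \<Longrightarrow> y \<in> Q \<Longrightarrow> x \<otimes> y = y \<otimes> x"
    and few: "card {x \<in> Q. x [^] p = \<one>} \<le> p"
  shows "\<exists>N. N \<lhd> G \<and> \<not> p dvd card N \<and> (\<exists>j. order G = p ^ j * card N)"
proof -
  let ?Q = "G\<lparr>carrier := Q\<rparr>"
  interpret Q: subgroup Q G by (rule Q)
  interpret QG: group ?Q by (rule Q.subgroup_is_group[OF is_group])
  interpret QC: comm_group ?Q using comm by (intro QG.group_comm_groupI) auto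
  \<comment> \<open>kept opaque, since the identity would turn the homomorphism laws into looping rewrite rules\<close>
  define \<iota> :: "'a \<Rightarrow> 'a" where "\<iota> = (\<lambda>x. x)"
  interpret transfer G ?Q Q \<iota>
    using fin Q by unfold_locales (auto simp: hom_def \<iota>_def)
  interpret Vh: group_hom G ?Q V using V_hom by (simp add: group_hom_def group_hom_axioms_def)
  define N where "N = kernel G ?Q V"
  have NG: "N \<lhd> G" unfolding N_def by (rule Vh.normal_kernel)
  have "card (rcosets\<^bsub>?Q\<^esub> (V ` carrier G)) * card (V ` carrier G) = p ^ k"
    using QG.lagrange[OF Vh.img_is_subgroup] Q(2) by (simp add: order_def)
  then have "card (V ` carrier G) dvd p ^ k" by (metis dvd_triv_right)
  then obtain j where j: "card (V ` carrier G) = p ^ j" using p by (metis divides_primepow_nat)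
  have ord: "order G = p ^ j * card N"
    using Vh.order_eq_card_kernel_image j by (simp add: N_def mult.commute)
  have "\<not> p dvd card N"
  proof
    assume pN: "p dvd card N"
    interpret N: subgroup N G using NG by (rule normal_imp_subgroup)
    interpret NGr: group "G\<lparr>carrier := N\<rparr>" by (rule N.subgroup_is_group[OF is_group])
    have "finite N" using fin N.subset finite_subset by blast
    then have "finite (carrier (G\<lparr>carrier := N\<rparr>))" "p dvd order (G\<lparr>carrier := N\<rparr>)"
      using pN by (simp_all add: order_def)
    from NGr.cauchy[OF this(1) p(1) this(2)] obtain w where
      "w \<in> carrier (G\<lparr>carrier := N\<rparr>)" "w \<noteq> \<one>\<^bsub>G\<lparr>carrier := N\<rparr>\<^esub>"
      "w [^]\<^bsub>G\<lparr>carrier := N\<rparr>\<^esub> p = \<one>\<^bsub>G\<lparr>carrier := N\<rparr>\<^esub>" .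
    then have w: "w \<in> N" "w \<noteq> \<one>" "w [^] p = \<one>" by (simp_all flip: nat_pow_consistent)
    have wG: "w \<in> carrier G" using w by simp
    let ?P = "(\<lambda>i::nat. w [^] i) ` {..<p}"
    let ?F = "{c \<in> rcosets Q. c #> w = c}"
    have P: "subgroup ?P G" "card ?P = p" using powers_subgroup_prime[OF fin p(1) wG w(3,2)] by auto
    have "w \<in> ?P" using prime_gt_1_nat[OF p(1)] wG by (auto intro!: image_eqI[of _ _ 1])
    then have F: "{c \<in> rcosets Q. \<forall>s \<in> ?P. c #> s = c} = ?F"
      using fixed_r_coset_pow wG rcoset_subset by blast
    have cong: "[card (rcosets Q) = card {c \<in> rcosets Q. \<forall>s \<in> ?P. c #> s = c}] (mod p)"
      using P rcosets_subset_PowG[OF Q(1)] subgroup.subset[OF P(1)]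
      by (intro card_cong_fixed_r_cosets[where k = 1] p(1)) auto
    have m: "\<not> p dvd card ?F" using cong_dvd_iff[OF cong] Q(3) unfolding F by blast
    then have "card ?F \<noteq> 0" by (intro notI) simp
    then have "?F \<noteq> {}" by (intro notI) simp
    then obtain c where c: "c \<in> rcosets Q" "c #> w = c" by blast
    define z where "z = rep c \<otimes> w \<otimes> inv (rep c)"
    have zQ: "z \<in> Q" using \<theta>_conj_rep(1)[OF c(1) wG c(2) rep_in[OF c(1)]] by (simp add: z_def)
    then have zG: "z \<in> carrier G" by simp
    have zp: "z [^] p = \<one>" using w(3) wG c(1) by (simp add: z_def flip: conj_pow)
    have z1: "z \<noteq> \<one>"
    proof
      assume "z = \<one>"
      then have "inv (rep c) \<otimes> (z \<otimes> rep c) = \<one>" using c(1) by simp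
      then show False using w(2) wG c(1) by (simp add: z_def m_assoc inv_mult_cancel)
    qed
    have "(\<lambda>i::nat. z [^] i) ` {..<p} = {x \<in> Q. x [^] p = \<one>}"
    proof (rule card_seteq)
      show "finite {x \<in> Q. x [^] p = \<one>}" using fin Q.subset by (auto intro: finite_subset[of _ "carrier G"])
      have "(z [^] i) [^] p = \<one>" for i :: nat
        using zG zp by (metis mult.commute nat_pow_one nat_pow_pow)
      moreover have "z [^] i \<in> Q" for i :: nat by (induction i) (use zQ in auto)
      ultimately show "(\<lambda>i::nat. z [^] i) ` {..<p} \<subseteq> {x \<in> Q. x [^] p = \<one>}" by auto
      show "card {x \<in> Q. x [^] p = \<one>} \<le> card ((\<lambda>i::nat. z [^] i) ` {..<p})"
        using few powers_subgroup_prime(2)[OF fin p(1) zG zp z1] by simp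
    qed
    note pows = this
    have const: "rep d \<otimes> w \<otimes> inv (rep d) = z" if d: "d \<in> ?F" for d
    proof -
      have dR: "d \<in> rcosets Q" "d #> w = d" using d by auto
      define r where "r = rep d \<otimes> inv (rep c)"
      have rG: "r \<in> carrier G" using c dR by (simp add: r_def)
      have conj: "r \<otimes> z \<otimes> inv r = rep d \<otimes> w \<otimes> inv (rep d)"
        using c dR wG by (simp add: r_def z_def m_assoc inv_mult_group inv_mult_cancel)
      have "rep d \<otimes> w \<otimes> inv (rep d) \<in> Q"
        using \<theta>_conj_rep(1)[OF dR(1) wG dR(2) rep_in[OF dR(1)]] .
      moreover have "(r \<otimes> z \<otimes> inv r) [^] p = \<one>" using zp zG rG by (simp flip: conj_pow)
      ultimately have "r \<otimes> z \<otimes> inv r \<in> (\<lambda>i::nat. z [^] i) ` {..<p}" using conj pows by simp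
      then obtain i :: nat where i: "r \<otimes> z \<otimes> inv r = z [^] i" by auto
      \<comment> \<open>With the trivial subgroup as \<open>M\<close>, congruence modulo
        \<open>M\<close> is equality.\<close>
      have "r \<otimes> z \<otimes> inv r \<in> {\<one>} #> z"
        by (rule conj_trivial_mod[OF triv_subgroup zG _ _ _ p fin rG, where k = i])
          (use z1 zp zG rG i in \<open>auto simp: r_coset_def\<close>)
      then show ?thesis using conj zG by (simp add: r_coset_def)
    qed
    \<comment> \<open>So \<open>V w\<close> is \<open>z\<close> to the number of fixed cosets, an
      exponent prime to \<open>p\<close>, and cannot be 1.\<close>
    have "V w = (\<Otimes>\<^bsub>?Q\<^esub>d\<in>?F. \<iota> (rep d \<otimes> w \<otimes> inv (rep d)))"
      by (rule V_order_p[OF p(1) wG w(3)])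
    also have "\<dots> = (\<Otimes>\<^bsub>?Q\<^esub>d\<in>?F. z)"
    proof (rule QC.finprod_cong'[OF refl])
      show "\<iota> (rep d \<otimes> w \<otimes> inv (rep d)) = z" if "d \<in> ?F" for d
        unfolding \<iota>_def using const[OF that] .
    qed (simp add: zQ)
    also have "\<dots> = z [^]\<^bsub>?Q\<^esub> card ?F" by (rule QC.finprod_const) (simp add: zQ)
    also have "\<dots> = z [^] card ?F" by (rule nat_pow_consistent[symmetric])
    finally have "z [^] card ?F = \<one>" using w(1) unfolding N_def kernel_def by simp
    then have "p dvd card ?F"
      using pow_mem_imp_prime_dvd[OF triv_subgroup zG _ _ p(1), of "card ?F"] z1 zp by simp
    with m show False by simp
  qed
  then show ?thesis using NG ord by blast
qed

section \<open>Groups with two abelian maximal subgroups\<close>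

lemma odd_prime_dvd_sum:
  assumes "odd (p::nat)"
  shows "p dvd (\<Sum>j<p. j)"
proof -
  have "2 * (\<Sum>j<n. j) = n * (n - 1)" for n :: nat
  proof (induction n)
    case (Suc n)
    then show ?case by (cases n) (auto simp: algebra_simps)
  qed simp
  then have "p dvd 2 * (\<Sum>j<p. j)" by simp
  moreover have "coprime p 2" using assms by (simp add: coprime_commute)
  ultimately show ?thesis by (simp add: coprime_dvd_mult_right_iff)
qed

lemma (in group) pow_eq_one_dvd:
  "x \<in> carrier G \<Longrightarrow> x [^] (p::nat) = \<one> \<Longrightarrow> p dvd n \<Longrightarrow> x [^] n = \<one>"
  using pow_eq_id dvd_trans by blast

lemma (in group) pow_cong:
  assumes "x \<in> carrier G" "x [^] (p::nat) = \<one>" "[m = n] (mod p)"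
  shows "x [^] m = x [^] n"
proof -
  have "x [^] i = x [^] (i mod p)" for i
  proof -
    have "x [^] i = (x [^] p) [^] (i div p) \<otimes> x [^] (i mod p)"
      using assms(1) by (simp add: nat_pow_pow nat_pow_mult)
    then show ?thesis using assms(1,2) by simp
  qed
  then show ?thesis using assms(3) by (metis unique_euclidean_semiring_class.cong_def)
qed

text \<open>The exponents of \<open>a\<close> add up to \<open>i * p * (p - 1) / 2\<close>, a
  multiple of \<open>p\<close> because \<open>p\<close> is odd.\<close>

lemma (in comm_group) finprod_arith_powers:
  assumes "a \<in> carrier G" "b \<in> carrier G" "a [^] (p::nat) = \<one>" "b [^] p = \<one>" "odd p"
  shows "(\<Otimes>j\<in>{..<p}. a [^] (i * j :: nat) \<otimes> b) = \<one>"
proof -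
  have "(\<Otimes>j\<in>{..<n}. a [^] (i * j)) = a [^] (i * (\<Sum>j<n. j))" for n :: nat
    by (induction n) (use assms(1) in \<open>auto simp: lessThan_Suc nat_pow_mult algebra_simps\<close>)
  then have "(\<Otimes>j\<in>{..<p}. a [^] (i * j)) = \<one>"
    using pow_eq_one_dvd[OF assms(1,3)] odd_prime_dvd_sum[OF assms(5)] by simp
  moreover have "(\<Otimes>j\<in>{..<p}. b) = \<one>" using finprod_const[OF assms(2), of "{..<p}"] assms by simp
  moreover have "(\<Otimes>j\<in>{..<p}. a [^] (i * j :: nat) \<otimes> b) = (\<Otimes>j\<in>{..<p}. a [^] (i * j)) \<otimes> (\<Otimes>j\<in>{..<p}. b)"
    using assms by (intro finprod_multf) auto
  ultimately show ?thesis by simp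
qed

text \<open>Grouped by value, a product depends only on how often each value occurs, and modulo
  \<open>p\<close> at that, since every value has order dividing \<open>p\<close>.\<close>

lemma (in comm_group) finprod_eq_levels:
  assumes "finite Y" "f \<in> Y \<rightarrow> carrier G"
    and "\<And>c. c \<in> Y \<Longrightarrow> f c [^] (p::nat) = \<one>" "Z \<subseteq> Y"
    and "\<And>a. [card {c \<in> Y. f c = a} = card {c \<in> Z. f c = a}] (mod p)"
  shows "finprod G f Y = finprod G f Z"
proof -
  have *: "finprod G f W = (\<Otimes>a\<in>f ` Y. a [^] card {c \<in> W. f c = a})" if "W \<subseteq> Y" for W
  proof -
    have finW: "finite W" using that assms(1) finite_subset by blast
    have fW: "f \<in> W \<rightarrow> carrier G" using that assms(2) by auto
    have "W = (\<Union>a\<in>f ` Y. {c \<in> W. f c = a})" using that by auto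
    then have "finprod G f W = finprod G f (\<Union>a\<in>f ` Y. {c \<in> W. f c = a})" by simp
    also have "\<dots> = (\<Otimes>a\<in>f ` Y. finprod G f {c \<in> W. f c = a})"
      using assms(1) finW fW by (intro finprod_UN_disjoint) (auto simp: pairwise_def disjnt_def)
    also have "\<dots> = (\<Otimes>a\<in>f ` Y. a [^] card {c \<in> W. f c = a})"
    proof (rule finprod_cong'[OF refl])
      fix a assume "a \<in> f ` Y"
      then have a: "a \<in> carrier G" using assms(2) by auto
      have "finprod G f {c \<in> W. f c = a} = finprod G (\<lambda>_. a) {c \<in> W. f c = a}"
        using a by (intro finprod_cong') auto
      then show "finprod G f {c \<in> W. f c = a} = a [^] card {c \<in> W. f c = a}"
        using finprod_const[OF a] by simp
    qed (use assms(2) in auto)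
    finally show ?thesis .
  qed
  have "(\<Otimes>a\<in>f ` Y. a [^] card {c \<in> Y. f c = a}) = (\<Otimes>a\<in>f ` Y. a [^] card {c \<in> Z. f c = a})"
  proof (rule finprod_cong'[OF refl])
    fix a assume "a \<in> f ` Y"
    then have "a \<in> carrier G" "a [^] p = \<one>" using assms(2,3) by auto
    then show "a [^] card {c \<in> Y. f c = a} = a [^] card {c \<in> Z. f c = a}"
      using pow_cong assms(5) by blast
  qed (use assms(2) in auto)
  then show ?thesis using *[of Y] *[OF assms(4)] by simp
qed

section \<open>Commutators in a \<open>p\<close>-group with two abelian maximal subgroups\<close>

lemma (in group) p_subgroup_index_ge:
  assumes "card W = p ^ k" "Factorial_Ring.prime p" "subgroup U G" "subgroup W G" "U \<subset> W"
  shows "p * card U \<le> card W"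
proof -
  have fW: "finite W" using assms(1,2) by (metis card_ge_0_finite prime_gt_0_nat zero_less_power)
  interpret W: subgroup W G by fact
  interpret WG: group "G\<lparr>carrier := W\<rparr>" by (rule W.subgroup_is_group[OF is_group])
  let ?i = "card (rcosets\<^bsub>G\<lparr>carrier := W\<rparr>\<^esub> U)"
  have "subgroup U (G\<lparr>carrier := W\<rparr>)" using assms by (intro subgroup_incl) auto
  then have l: "?i * card U = card W" using WG.lagrange by (simp add: order_def)
  have "card U < card W" using fW assms(5) by (rule psubset_card_mono)
  then have "?i \<noteq> 1" using l by auto
  moreover have "?i dvd p ^ k" using l assms(1) by (metis dvd_triv_left)
  ultimately have "p dvd ?i"
    using assms(2) by (metis (no_types, lifting) divides_primepow_nat dvd_power gr_zeroI power_0)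
  moreover have "?i \<noteq> 0" using l \<open>card U < card W\<close> by (metis mult_0 not_less_zero)
  ultimately have "p \<le> ?i" by (simp add: dvd_imp_le)
  then show ?thesis using l by (metis mult_le_mono1)
qed

text \<open>Anything in \<open>M1 \<inter> M2\<close> commutes with \<open>M1\<close> and
  \<open>M2\<close>, hence is central. This applies to all \<open>p\<close>-th powers and, both
  subgroups being normal, to the commutator \<open>d\<close> of \<open>a\<close> in
  \<open>M1\<close> and \<open>b\<close> in \<open>M2\<close>. Centrality makes commutators
  bilinear, so \<open>d\<close> generates all of them.\<close>

lemma (in group) two_abelian_maximal_subgroups:
  assumes G: "order G = p ^ k" "Factorial_Ring.prime p"
    and M: "maximal_subgroup M1 G" "maximal_subgroup M2 G" "M1 \<noteq> M2"
    and ab1: "\<And>x y. x \<in> M1 \<Longrightarrow> y \<in> M1 \<Longrightarrow> x \<otimes> y = y \<otimes> x"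
    and ab2: "\<And>x y. x \<in> M2 \<Longrightarrow> y \<in> M2 \<Longrightarrow> x \<otimes> y = y \<otimes> x"
  obtains a b d where "a \<in> carrier G" "b \<in> carrier G" "d \<in> carrier G" "a \<otimes> b = d \<otimes> (b \<otimes> a)"
    "d [^] p = \<one>" "\<And>x. x \<in> carrier G \<Longrightarrow> d \<otimes> x = x \<otimes> d"
    "\<And>x y. x \<in> carrier G \<Longrightarrow> y \<in> carrier G \<Longrightarrow> \<exists>i::nat. x \<otimes> y = d [^] i \<otimes> (y \<otimes> x)"
    "\<And>x y. x \<in> carrier G \<Longrightarrow> y \<in> carrier G \<Longrightarrow> x [^] p \<otimes> y = y \<otimes> x [^] p"
proof -
  have fin: "finite (carrier G)"
    using G order_gt_0_iff_finite by (metis prime_gt_0_nat zero_less_power)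
  interpret M1: normal M1 G by (rule maximal_subgroup_p_group_normal[OF G M(1)])
  interpret M2: normal M2 G by (rule maximal_subgroup_p_group_normal[OF G M(2)])
  have max1: "U = carrier G" if "subgroup U G" "M1 \<subseteq> U" "y \<in> U" "y \<notin> M1" for U y
    using M(1) that by (auto simp: maximal_subgroup_def)
  have max2: "U = carrier G" if "subgroup U G" "M2 \<subseteq> U" "y \<in> U" "y \<notin> M2" for U y
    using M(2) that by (auto simp: maximal_subgroup_def)
  have "\<not> M1 \<subseteq> M2" "\<not> M2 \<subseteq> M1"
    using M M1.subgroup_axioms M2.subgroup_axioms unfolding maximal_subgroup_def by metis+
  then obtain a b where a: "a \<in> M1" "a \<notin> M2" and b: "b \<in> M2" "b \<notin> M1" by blast
  have aG: "a \<in> carrier G" and bG: "b \<in> carrier G" using a b by auto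
  define d where "d = a \<otimes> b \<otimes> inv a \<otimes> inv b"
  have central: "z \<otimes> x = x \<otimes> z" if z: "z \<in> M1" "z \<in> M2" and x: "x \<in> carrier G" for z x
  proof -
    let ?U = "{x \<in> carrier G. z \<otimes> x = x \<otimes> z}"
    have "subgroup ?U G"
    proof (rule finite_subgroupI[OF fin])
      fix x y assume "x \<in> ?U" "y \<in> ?U"
      then have xy: "x \<in> carrier G" "y \<in> carrier G" "z \<otimes> x = x \<otimes> z" "z \<otimes> y = y \<otimes> z" by auto
      have "z \<otimes> (x \<otimes> y) = x \<otimes> (z \<otimes> y)" using xy z by (metis M1.mem_carrier m_assoc)
      also have "\<dots> = x \<otimes> y \<otimes> z" using xy z by (simp add: m_assoc)
      finally show "x \<otimes> y \<in> ?U" using xy by simp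
    qed (use z in auto)
    then have "?U = carrier G" using ab1[OF z(1)] ab2[OF z(2)] b by (intro max1[of _ b]) auto
    then show ?thesis using x by blast
  qed
  have "d = a \<otimes> (b \<otimes> inv a \<otimes> inv b)" using aG bG by (simp add: d_def m_assoc)
  then have d1: "d \<in> M1" using a bG M1.inv_op_closed2[OF bG, of "inv a"] by simp
  have d2: "d \<in> M2" using b aG M2.inv_op_closed2[OF aG b(1)] by (simp add: d_def)
  have dG: "d \<in> carrier G" using d1 by simp
  note dc = central[OF d1 d2]
  have ab: "a \<otimes> b = d \<otimes> (b \<otimes> a)" using aG bG by (simp add: d_def m_assoc inv_mult_cancel)
  have pc: "x [^] p \<otimes> y = y \<otimes> x [^] p" if "x \<in> carrier G" "y \<in> carrier G" for x y
    using that by (intro central maximal_subgroup_p_group_pow[OF G M(1)] maximal_subgroup_p_group_pow[OF G M(2)])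
  have dpc: "d [^] (i::nat) \<otimes> x = x \<otimes> d [^] i" if "x \<in> carrier G" for i x
    by (rule group_commutes_pow) (use dc that dG in auto)
  \<comment> \<open>At \<open>i = p\<close> the power of \<open>a\<close> is central, so its
    commutator \<open>d [^] p\<close> with \<open>b\<close> is trivial.\<close>
  have "a [^] (i::nat) \<otimes> b = d [^] i \<otimes> (b \<otimes> a [^] i)" for i
  proof (induction i)
    case (Suc i)
    have "a [^] Suc i \<otimes> b = a \<otimes> (a [^] i \<otimes> b)" using aG bG by (simp only: nat_pow_Suc2) (simp add: m_assoc)
    also have "\<dots> = a \<otimes> d [^] i \<otimes> (b \<otimes> a [^] i)" using Suc aG bG dG by (simp add: m_assoc)
    also have "\<dots> = d [^] i \<otimes> (a \<otimes> b) \<otimes> a [^] i" using dpc[OF aG, of i] aG bG dG by (simp flip: m_assoc)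
    also have "\<dots> = d [^] Suc i \<otimes> (b \<otimes> (a \<otimes> a [^] i))" using ab aG bG dG by (simp add: m_assoc)
    finally show ?case using nat_pow_Suc2[OF aG, of i] by simp
  qed (use bG in simp)
  from this[of p] have "d [^] p \<otimes> (b \<otimes> a [^] p) = \<one> \<otimes> (b \<otimes> a [^] p)" using pc[OF aG bG] aG bG by simp
  then have dp: "d [^] p = \<one>" using aG bG dG by (metis m_closed nat_pow_closed one_closed right_cancel)
  let ?C = "\<lambda>x y. \<exists>i::nat. x \<otimes> y = d [^] i \<otimes> (y \<otimes> x)"
  have C0: "?C x y" if "x \<in> carrier G" "y \<in> carrier G" "x \<otimes> y = y \<otimes> x" for x y
    using that by (intro exI[of _ 0]) simp
  have sub1: "subgroup {x \<in> carrier G. ?C x y} G" if y: "y \<in> carrier G" for y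
  proof (rule finite_subgroupI[OF fin])
    fix x x' assume "x \<in> {x \<in> carrier G. ?C x y}" "x' \<in> {x \<in> carrier G. ?C x y}"
    then obtain i j :: nat where x: "x \<in> carrier G" "x' \<in> carrier G"
      "x \<otimes> y = d [^] i \<otimes> (y \<otimes> x)" "x' \<otimes> y = d [^] j \<otimes> (y \<otimes> x')" by auto
    have "x \<otimes> x' \<otimes> y = x \<otimes> d [^] j \<otimes> (y \<otimes> x')" using x dG y by (simp add: m_assoc)
    also have "\<dots> = d [^] j \<otimes> (x \<otimes> y) \<otimes> x'" using dpc[OF x(1), of j] x(1,2) dG y by (simp flip: m_assoc)
    also have "\<dots> = d [^] (j + i) \<otimes> (y \<otimes> (x \<otimes> x'))" using x dG y by (simp add: m_assoc flip: nat_pow_mult)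
    finally show "x \<otimes> x' \<in> {x \<in> carrier G. ?C x y}" using x by blast
  qed (use C0[OF one_closed] that in auto)
  have sub2: "subgroup {y \<in> carrier G. ?C x y} G" if x: "x \<in> carrier G" for x
  proof (rule finite_subgroupI[OF fin])
    fix y y' assume "y \<in> {y \<in> carrier G. ?C x y}" "y' \<in> {y \<in> carrier G. ?C x y}"
    then obtain i j :: nat where y: "y \<in> carrier G" "y' \<in> carrier G"
      "x \<otimes> y = d [^] i \<otimes> (y \<otimes> x)" "x \<otimes> y' = d [^] j \<otimes> (y' \<otimes> x)" by auto
    have "x \<otimes> (y \<otimes> y') = d [^] i \<otimes> (y \<otimes> (x \<otimes> y'))" using y(1-3) dG x by (simp flip: m_assoc)
    also have "\<dots> = d [^] i \<otimes> (y \<otimes> d [^] j) \<otimes> (y' \<otimes> x)" using y dG x by (simp add: m_assoc)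
    also have "\<dots> = d [^] (i + j) \<otimes> (y \<otimes> y' \<otimes> x)"
      using dpc[OF y(1), of j, symmetric] y(1,2) dG x by (simp add: m_assoc flip: nat_pow_mult)
    finally show "y \<otimes> y' \<in> {y \<in> carrier G. ?C x y}" using y by blast
  qed (use C0[OF _ one_closed] that in auto)
  \<comment> \<open>The inverse of \<open>d\<close> is written as \<open>d [^] (p - 1)\<close>
    because exponents are natural numbers.\<close>
  have Cba: "?C b a"
  proof
    have "d [^] (p - 1) \<otimes> d = \<one>"
      using dp nat_pow_Suc[of d "p - 1"] prime_gt_0_nat[OF G(2)] by simp
    then have "d [^] (p - 1) \<otimes> (a \<otimes> b) = b \<otimes> a"
      using ab aG bG dG by (simp flip: m_assoc)
    then show "b \<otimes> a = d [^] (p - 1) \<otimes> (a \<otimes> b)" by simp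
  qed
  have Cab: "?C a b" using ab dG by (intro exI[of _ 1]) simp
  \<comment> \<open>Each application of maximality fixes one argument of \<open>?C\<close>: the
    admissible values of the other form a subgroup that contains \<open>M1\<close> or
    \<open>M2\<close> and also an element outside it.\<close>
  have "{y \<in> carrier G. ?C b y} = carrier G"
    using sub2[OF bG] by (rule max2[where y = a]) (use C0 ab2 a aG b bG Cba in auto)
  then have step1: "?C b y" if "y \<in> carrier G" for y using that by blast
  have "{x \<in> carrier G. ?C x b} = carrier G"
    using sub1[OF bG] by (rule max2[where y = a]) (use C0 ab2 a aG b bG Cab in auto)
  then have step2: "?C x b" if "x \<in> carrier G" for x using that by blast
  have step3: "?C x y" if "x \<in> carrier G" "y \<in> M1" for x y
  proof -
    have "{x \<in> carrier G. ?C x y} = carrier G"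
      using sub1[OF M1.mem_carrier[OF that(2)]]
      by (rule max1[where y = b]) (use C0 ab1 that b bG step1 in auto)
    then show ?thesis using that by blast
  qed
  have "?C x y" if "x \<in> carrier G" "y \<in> carrier G" for x y
  proof -
    have "{y \<in> carrier G. ?C x y} = carrier G"
      using sub2[OF that(1)] by (rule max1[where y = b]) (use that b bG step2 step3 in auto)
    then show ?thesis using that by blast
  qed
  then show thesis using that[OF aG bG dG ab dp dc] pc by blast
qed

section \<open>Transfer from a Sylow subgroup of class two\<close>

text \<open>\<open>S\<close> is a \<open>p\<close>-group whose commutator subgroup is generated by the central commutator
  \<open>d = [a, b]\<close>, and \<open>\<theta>\<close> is the projection onto the abelianization.\<close>
locale class2_transfer = transfer G A S \<theta> for G (structure) and A (structure) and S and \<theta> +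
  fixes p k :: nat and d a b
  assumes p: "Factorial_Ring.prime p" "odd p" and card_S: "card S = p ^ k"
    and abd: "a \<in> S" "b \<in> S" "d \<in> S" "a \<otimes> b = d \<otimes> (b \<otimes> a)" "d [^] p = \<one>"
    and d_central: "\<And>s. s \<in> S \<Longrightarrow> d \<otimes> s = s \<otimes> d"
    and comm: "\<And>s t. s \<in> S \<Longrightarrow> t \<in> S \<Longrightarrow> \<exists>i::nat. s \<otimes> t = d [^] i \<otimes> (t \<otimes> s)"
    and pow_central: "\<And>s t. s \<in> S \<Longrightarrow> t \<in> S \<Longrightarrow> s [^] p \<otimes> t = t \<otimes> s [^] p"
    and ker: "\<And>s. s \<in> S \<Longrightarrow> \<theta> s = \<one>\<^bsub>A\<^esub> \<longleftrightarrow> s \<in> range (\<lambda>i::nat. d [^] i)"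
    and onto: "\<theta> ` S = carrier A"
begin

section \<open>Powers and commutators in class two\<close>

lemma pow_in_S: "s \<in> S \<Longrightarrow> s [^] (i::nat) \<in> S"
  by (induction i) auto

lemma d_pow_central: "s \<in> S \<Longrightarrow> d [^] (i::nat) \<otimes> s = s \<otimes> d [^] i"
  using d_central abd by (intro G.group_commutes_pow) auto

lemma pow_commute_past:
  assumes "y \<in> S" "x \<in> S" "y \<otimes> x = d [^] (i::nat) \<otimes> (x \<otimes> y)"
  shows "y [^] (j::nat) \<otimes> x = d [^] (i * j) \<otimes> (x \<otimes> y [^] j)"
proof (induction j)
  case (Suc j)
  note dG = S.mem_carrier[OF abd(3)]
  note yj = pow_in_S[OF assms(1), of j]
  have "y [^] Suc j \<otimes> x = y [^] j \<otimes> (y \<otimes> x)" using assms(1,2) by (simp add: G.m_assoc)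
  also have "\<dots> = (y [^] j \<otimes> d [^] i) \<otimes> (x \<otimes> y)" using assms dG by (simp add: G.m_assoc)
  also have "\<dots> = d [^] i \<otimes> (y [^] j \<otimes> x) \<otimes> y"
    using d_pow_central[OF yj, of i, symmetric] assms(1,2) dG by (simp add: G.m_assoc)
  also have "\<dots> = d [^] (i + i * j) \<otimes> (x \<otimes> y [^] Suc j)"
    using Suc assms(1,2) dG by (simp add: G.m_assoc flip: G.nat_pow_mult)
  finally show ?case by simp
qed (use assms in simp)

text \<open>Collecting the factors \<open>s\<close> to the left costs \<open>d\<close> to the power
  \<open>i * (0 + ... + (p - 1))\<close>, which vanishes for odd \<open>p\<close>.\<close>

lemma pow_p_mult:
  assumes "s \<in> S" "t \<in> S"
  shows "(s \<otimes> t) [^] p = s [^] p \<otimes> t [^] p"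
proof -
  note dG = S.mem_carrier[OF abd(3)]
  obtain i :: nat where i: "t \<otimes> s = d [^] i \<otimes> (s \<otimes> t)" using comm assms by blast
  have "(s \<otimes> t) [^] n = d [^] (i * (\<Sum>j<n. j)) \<otimes> (s [^] n \<otimes> t [^] n)" for n :: nat
  proof (induction n)
    case (Suc n)
    let ?e = "i * (\<Sum>j<n. j)"
    have "(s \<otimes> t) [^] Suc n = d [^] ?e \<otimes> (s [^] n \<otimes> (t [^] n \<otimes> s) \<otimes> t)"
      using Suc assms dG by (simp add: G.m_assoc)
    also have "\<dots> = d [^] ?e \<otimes> ((s [^] n \<otimes> d [^] (i * n)) \<otimes> (s \<otimes> t [^] n \<otimes> t))"
      using pow_commute_past[OF assms(2,1) i, of n] assms dG by (simp add: G.m_assoc)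
    also have "\<dots> = d [^] ?e \<otimes> ((d [^] (i * n) \<otimes> s [^] n) \<otimes> (s \<otimes> t [^] n \<otimes> t))"
      using d_pow_central[OF pow_in_S[OF assms(1)]] by simp
    also have "\<dots> = d [^] (?e + i * n) \<otimes> (s [^] Suc n \<otimes> t [^] Suc n)"
      using assms dG by (simp add: G.m_assoc flip: G.nat_pow_mult)
    also have "?e + i * n = i * (\<Sum>j<Suc n. j)" by (simp add: algebra_simps)
    finally show ?case .
  qed simp
  moreover have "d [^] (i * (\<Sum>j<p. j)) = \<one>"
    using G.pow_eq_one_dvd[OF dG abd(5)] odd_prime_dvd_sum[OF p(2)] by simp
  ultimately show ?thesis using assms by simp
qed

lemma card_subgroup_power:
  assumes "subgroup U G" "U \<subseteq> S"
  shows "\<exists>j. card U = p ^ j"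
proof -
  have "subgroup U (G\<lparr>carrier := S\<rparr>)" using assms sub by (intro G.subgroup_incl) auto
  then have "card (rcosets\<^bsub>G\<lparr>carrier := S\<rparr>\<^esub> U) * card U = p ^ k"
    using group.lagrange[OF S.subgroup_is_group[OF G.is_group]] card_S by (simp add: order_def)
  then have "card U dvd p ^ k" by (metis dvd_triv_right)
  then show ?thesis using p(1) by (metis divides_primepow_nat)
qed

lemma centralizer_in_S: "x \<in> S \<Longrightarrow> subgroup {s \<in> S. s \<otimes> x = x \<otimes> s} G"
proof (rule G.finite_subgroupI[OF fin])
  fix s t assume x: "x \<in> S" and st: "s \<in> {s \<in> S. s \<otimes> x = x \<otimes> s}" "t \<in> {s \<in> S. s \<otimes> x = x \<otimes> s}"
  then have st': "s \<in> S" "t \<in> S" "s \<otimes> x = x \<otimes> s" "t \<otimes> x = x \<otimes> t" by auto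
  have "s \<otimes> t \<otimes> x = s \<otimes> (x \<otimes> t)" using st'(1,2,4) x by (simp add: G.m_assoc)
  also have "\<dots> = s \<otimes> x \<otimes> t" using st'(1,2) x by (simp add: G.m_assoc)
  also have "\<dots> = x \<otimes> (s \<otimes> t)" using st'(1,2) x by (simp add: st'(3) G.m_assoc)
  finally show "s \<otimes> t \<in> {s \<in> S. s \<otimes> x = x \<otimes> s}" using st by simp
qed auto

text \<open>If \<open>s\<close> and \<open>t\<close> do not commute, then \<open>?Z < ?C < Q\<close>
  are proper inclusions, since \<open>t\<close> is outside \<open>?C\<close> and \<open>s\<close> is
  in \<open>?C\<close> but outside \<open>?Z\<close>; so \<open>?Z\<close> has index at least
  \<open>p^2\<close>. But \<open>x \<mapsto> x [^] p\<close> maps \<open>Q\<close> into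
  \<open>?Z\<close> with a kernel of at most \<open>p\<close> elements.\<close>

lemma subgroup_few_abelian:
  assumes Q: "subgroup Q G" "Q \<subseteq> S" and few: "card {x \<in> Q. x [^] p = \<one>} \<le> p"
    and st: "s \<in> Q" "t \<in> Q"
  shows "s \<otimes> t = t \<otimes> s"
proof (rule ccontr)
  assume ne: "s \<otimes> t \<noteq> t \<otimes> s"
  interpret Q: subgroup Q G by (rule Q)
  have finS: "finite S" using fin S.subset finite_subset by blast
  let ?C = "{u \<in> S. u \<otimes> s = s \<otimes> u} \<inter> Q"
  let ?Z = "?C \<inter> {u \<in> S. u \<otimes> t = t \<otimes> u}"
  have C: "subgroup ?C G" and Z: "subgroup ?Z G"
    using centralizer_in_S st Q by (auto intro!: G.subgroups_Inter_pair)
  have "t \<notin> ?C" using ne by auto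
  have "?Z \<subset> ?C" using st Q ne by blast
  then have ZC: "p * card ?Z \<le> card ?C"
    using card_subgroup_power[OF C] G.p_subgroup_index_ge[OF _ p(1) Z C] Q by blast
  have "?C \<subset> Q" using st(2) \<open>t \<notin> ?C\<close> by blast
  then have CQ: "p * card ?C \<le> card Q"
    using card_subgroup_power[OF Q] G.p_subgroup_index_ge[OF _ p(1) C Q(1)] by blast
  have QZ: "card Q \<le> p * card ?Z"
  proof -
    let ?Q = "G\<lparr>carrier := Q\<rparr>"
    interpret h: group_hom ?Q G "\<lambda>x. x [^] p"
      using Q.subgroup_is_group[OF G.is_group] Q(2) pow_p_mult
      by (auto simp: group_hom_def group_hom_axioms_def hom_def subset_iff)
    have "kernel ?Q G (\<lambda>x. x [^] p) = {x \<in> Q. x [^] p = \<one>}" by (simp add: kernel_def)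
    then have cQ: "card Q = card {x \<in> Q. x [^] p = \<one>} * card ((\<lambda>x. x [^] p) ` Q)"
      using h.order_eq_card_kernel_image by (simp add: order_def)
    have "(\<lambda>x. x [^] p) ` Q \<subseteq> ?Z"
    proof -
      have "x [^] (j::nat) \<in> Q" if "x \<in> Q" for x j by (induction j) (use that in auto)
      moreover have "s \<in> S" "t \<in> S" using st Q(2) by auto
      ultimately show ?thesis using pow_in_S pow_central Q(2) by auto
    qed
    moreover have "finite ?Z" by (rule finite_subset[OF _ finS]) blast
    ultimately have "card ((\<lambda>x. x [^] p) ` Q) \<le> card ?Z" by (intro card_mono)
    then show ?thesis using few cQ mult_le_mono by auto
  qed
  have "card ?Z > 0" using subgroup.finite_imp_card_positive[OF Z fin] .
  moreover have "p * (p * card ?Z) \<le> p * card ?Z"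
    using mult_le_mono2[OF ZC, of p] CQ QZ by linarith
  ultimately show False using prime_gt_1_nat[OF p(1)] by simp
qed

section \<open>The transfer on elements with \<open>x^p = 1\<close>\<close>

abbreviation R where "R \<equiv> rcosets S"
abbreviation f where "f x c \<equiv> \<theta> (rep c \<otimes> x \<otimes> inv (rep c))"

text \<open>\<open>Fix\<close> consists of the cosets \<open>S t\<close> with \<open>t\<close> in the normalizer of \<open>S\<close>.\<close>
definition Fix where "Fix = {c \<in> R. \<forall>s\<in>S. c #> s = c}"
definition T where "T x = finprod A (f x) Fix"

lemma rep_shift: "c \<in> R \<Longrightarrow> s \<in> carrier G \<Longrightarrow> rep c \<otimes> s \<in> c #> s"
  using rep_in by (auto simp: r_coset_def)

text \<open>Non-fixed orbits on the cosets contribute nothing: first those of \<open>x\<close>, then those of its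
  centralizer \<open>C\<close> in \<open>S\<close>, on which the factors are constant of order dividing \<open>p\<close>, and finally those
  of some \<open>y \<in> S - C\<close>, on which the factors form a progression of odd length \<open>p\<close>.\<close>
lemma V_eq_T:
  assumes x: "x \<in> S" "x [^] p = \<one>"
  shows "V x = T x"
proof -
  have xG: "x \<in> carrier G" using x by simp
  note dG = S.mem_carrier[OF abd(3)]
  define C where "C = {s \<in> S. s \<otimes> x = x \<otimes> s}"
  define F where "F = {c \<in> R. c #> x = c}"
  define E where "E = {c \<in> R. \<forall>s\<in>C. c #> s = c}"
  have CG: "subgroup C G" unfolding C_def by (rule centralizer_in_S[OF x(1)])
  interpret C: subgroup C G by (rule CG)
  have xC: "x \<in> C" using x by (simp add: C_def)
  have dC: "d \<in> C" using d_central abd x by (simp add: C_def)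
  then have dpC: "d [^] (i::nat) \<in> C" for i by (induction i) auto
  have EF: "E \<subseteq> F" using xC by (auto simp: E_def F_def)
  have fF: "f x c \<in> carrier A" if "c \<in> F" for c
    using that \<theta>_conj_rep(1)[OF _ xG _ rep_in] by (auto simp: F_def)
  have f_alt: "t \<otimes> x \<otimes> inv t \<in> S" "f x c = \<theta> (t \<otimes> x \<otimes> inv t)" if "c \<in> F" "t \<in> c" for c t
    using that \<theta>_conj_rep[OF _ xG] by (auto simp: F_def)
  have fp: "f x c [^]\<^bsub>A\<^esub> p = \<one>\<^bsub>A\<^esub>" if "c \<in> F" for c
  proof -
    have cR: "c \<in> R" using that by (simp add: F_def)
    have "f x c [^]\<^bsub>A\<^esub> p = \<theta> ((rep c \<otimes> x \<otimes> inv (rep c)) [^] p)"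
      using \<theta>.hom_nat_pow[of "rep c \<otimes> x \<otimes> inv (rep c)" p] f_alt(1)[OF that rep_in[OF cR]]
      by (simp flip: G.nat_pow_consistent)
    also have "\<dots> = \<one>\<^bsub>A\<^esub>" using x cR xG by (simp flip: G.conj_pow)
    finally show ?thesis .
  qed
  obtain l where l: "card C = p ^ l" using card_subgroup_power[OF CG] by (auto simp: C_def)
  have shiftC: "c #> s \<in> F" "f x (c #> s) = f x c" if c: "c \<in> F" and s: "s \<in> C" for c s
  proof -
    have cR: "c \<in> R" and cx: "c #> x = c" using c by (auto simp: F_def)
    have sG: "s \<in> carrier G" and sx: "s \<otimes> x = x \<otimes> s" using s by (auto simp: C_def)
    have "c #> s #> x = c #> x #> s"
      using sx sG xG rcoset_subset[OF cR] by (simp add: G.coset_mult_assoc)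
    then show cF: "c #> s \<in> F" using cx cR sG by (simp add: F_def)
    have "f x (c #> s) = \<theta> (rep c \<otimes> s \<otimes> x \<otimes> inv (rep c \<otimes> s))"
      by (rule f_alt(2)[OF cF rep_shift[OF cR sG]])
    also have "rep c \<otimes> s \<otimes> x \<otimes> inv (rep c \<otimes> s) = rep c \<otimes> (s \<otimes> x) \<otimes> inv s \<otimes> inv (rep c)"
      using cR sG xG by (simp add: G.m_assoc G.inv_mult_group)
    also have "\<dots> = rep c \<otimes> x \<otimes> inv (rep c)"
      using cR sG xG by (simp add: sx G.m_assoc)
    finally show "f x (c #> s) = f x c" .
  qed
  have "V x = finprod A (f x) F"
    using V_order_p[OF p(1) xG x(2)] by (simp add: F_def)
  \<comment> \<open>\<open>f x\<close> is constant on \<open>C\<close>-orbits, so \<open>C\<close>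
    acts on each of its level sets, and passing to \<open>E\<close> changes their sizes by multiples
    of \<open>p\<close>.\<close>
  also have "\<dots> = finprod A (f x) E"
  proof (rule A.finprod_eq_levels[OF _ _ fp EF])
    show "finite F" by (simp add: F_def)
    fix z
    have "[card {c \<in> F. f x c = z} = card {c \<in> {c \<in> F. f x c = z}. \<forall>s\<in>C. c #> s = c}] (mod p)"
      using \<open>finite F\<close> rcoset_subset shiftC
      by (intro G.card_cong_fixed_r_cosets[OF CG l p(1)]) (auto simp: F_def)
    moreover have "{c \<in> {c \<in> F. f x c = z}. \<forall>s\<in>C. c #> s = c} = {c \<in> E. f x c = z}"
      using EF by (auto simp: E_def F_def)
    ultimately show "[card {c \<in> F. f x c = z} = card {c \<in> E. f x c = z}] (mod p)" by simp
  qed (use fF in auto)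
  also have "\<dots> = finprod A (f x) Fix"
  proof (cases "C = S")
    case True
    then show ?thesis by (simp add: E_def Fix_def)
  next
    case False
    then obtain y where y: "y \<in> S" "y \<notin> C" by (auto simp: C_def)
    have yG: "y \<in> carrier G" using y by simp
    obtain i :: nat where i: "y \<otimes> x = d [^] i \<otimes> (x \<otimes> y)" using comm y x by blast
    have "\<not> p dvd i"
    proof
      assume "p dvd i"
      then have "y \<otimes> x = x \<otimes> y" using i G.pow_eq_one_dvd[OF dG abd(5)] xG yG by simp
      then show False using y by (simp add: C_def)
    qed
    have iter: "((\<lambda>c. c #> y) ^^ j) c = c #> y [^] j" if "c \<in> R" for c j
      by (induction j) (use yG that rcoset_subset in \<open>auto simp: G.coset_mult_assoc\<close>)
    \<comment> \<open>\<open>C\<close> contains all powers of \<open>d\<close>, hence the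
      commutators of \<open>S\<close>, and is therefore normalized by \<open>y\<close>.\<close>
    have shiftE: "c #> y \<in> E" if "c \<in> E" for c
    proof -
      have cR: "c \<in> R" and cC: "\<And>s. s \<in> C \<Longrightarrow> c #> s = c" using that by (auto simp: E_def)
      have "c #> y #> s = c #> y" if s: "s \<in> C" for s
      proof -
        have sS: "s \<in> S" using s by (simp add: C_def)
        obtain l :: nat where "y \<otimes> s = d [^] l \<otimes> (s \<otimes> y)" using comm[OF y(1) sS] by blast
        then have "y \<otimes> s = (d [^] l \<otimes> s) \<otimes> y" using yG sS dG by (simp add: G.m_assoc)
        then have "c #> y #> s = c #> (d [^] l \<otimes> s) #> y"
          using yG sS dG rcoset_subset[OF cR] by (simp add: G.coset_mult_assoc)
        then show ?thesis using cC[of "d [^] l \<otimes> s"] dpC s by simp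
      qed
      then show ?thesis using cR yG by (simp add: E_def)
    qed
    have "finprod A (f x) E = finprod A (f x) {c \<in> E. c #> y = c}"
    proof (rule A.finprod_prime_cycles[OF p(1)])
      show "finite E" by (simp add: E_def)
      show "(\<lambda>c. c #> y) \<in> E \<rightarrow> E" using shiftE by auto
      show "f x \<in> E \<rightarrow> carrier A" using fF EF by blast
      fix c assume cE: "c \<in> E"
      then have cR: "c \<in> R" and cC: "\<And>s. s \<in> C \<Longrightarrow> c #> s = c" by (auto simp: E_def)
      \<comment> \<open>\<open>p\<close>-th powers are central in \<open>S\<close>, so
        \<open>y\<close> acts on the cosets fixed by \<open>C\<close> with order dividing
        \<open>p\<close>.\<close>
      have "y [^] p \<in> C" using pow_central[OF y(1) x(1)] pow_in_S[OF y(1)] by (simp add: C_def)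
      then show "((\<lambda>c. c #> y) ^^ p) c = c" using iter[OF cR] cC by simp
      \<comment> \<open>Moving \<open>y [^] j\<close> past \<open>x\<close> costs
        \<open>d [^] (i * j)\<close>; conjugated by \<open>rep c\<close>, the factor at the
        \<open>j\<close>-th coset of the cycle becomes
        \<open>?\<alpha> [^] (i * j) \<otimes> ?\<beta>\<close>.\<close>
      let ?\<alpha> = "rep c \<otimes> d \<otimes> inv (rep c)" and ?\<beta> = "rep c \<otimes> x \<otimes> inv (rep c)"
      have \<alpha>S: "?\<alpha> \<in> S" using \<theta>_conj_rep(1)[OF cR dG cC[OF dC] rep_in[OF cR]] .
      have \<beta>S: "?\<beta> \<in> S" using \<theta>_conj_rep(1)[OF cR xG cC[OF xC] rep_in[OF cR]] .
      have \<alpha>p: "\<theta> ?\<alpha> [^]\<^bsub>A\<^esub> j = \<theta> (?\<alpha> [^] j)" for j :: nat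
        using \<theta>.hom_nat_pow[of ?\<alpha> j] \<alpha>S by (simp flip: G.nat_pow_consistent)
      have "f x (((\<lambda>c. c #> y) ^^ j) c) = \<theta> ?\<alpha> [^]\<^bsub>A\<^esub> (i * j) \<otimes>\<^bsub>A\<^esub> \<theta> ?\<beta>" for j
      proof -
        have yj: "y [^] j \<in> carrier G" using yG by simp
        have "c #> y [^] j \<in> F"
        proof -
          have "((\<lambda>c. c #> y) ^^ j) c \<in> E" by (induction j) (use cE shiftE in auto)
          then show ?thesis using iter[OF cR] EF by auto
        qed
        then have "f x (c #> y [^] j) = \<theta> (rep c \<otimes> y [^] j \<otimes> x \<otimes> inv (rep c \<otimes> y [^] j))"
          by (rule f_alt(2)) (rule rep_shift[OF cR yj])
        also have "rep c \<otimes> y [^] j \<otimes> x \<otimes> inv (rep c \<otimes> y [^] j) =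
            rep c \<otimes> (y [^] j \<otimes> x) \<otimes> inv (y [^] j) \<otimes> inv (rep c)"
          using cR yj xG by (simp add: G.m_assoc G.inv_mult_group)
        also have "\<dots> = rep c \<otimes> d [^] (i * j) \<otimes> x \<otimes> inv (rep c)"
          using pow_commute_past[OF y(1) x(1) i, of j] cR yj xG dG by (simp add: G.m_assoc)
        also have "\<dots> = (rep c \<otimes> d [^] (i * j) \<otimes> inv (rep c)) \<otimes> ?\<beta>"
          using cR xG dG by (simp add: G.m_assoc G.inv_mult_cancel)
        also have "rep c \<otimes> d [^] (i * j) \<otimes> inv (rep c) = ?\<alpha> [^] (i * j)"
          using cR dG by (simp add: G.conj_pow)
        also have "\<theta> (?\<alpha> [^] (i * j) \<otimes> ?\<beta>) = \<theta> ?\<alpha> [^]\<^bsub>A\<^esub> (i * j) \<otimes>\<^bsub>A\<^esub> \<theta> ?\<beta>"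
          using \<theta>_mult[OF pow_in_S[OF \<alpha>S] \<beta>S] \<alpha>p by simp
        finally show ?thesis using iter[OF cR] by simp
      qed
      moreover have "\<theta> ?\<alpha> [^]\<^bsub>A\<^esub> p = \<one>\<^bsub>A\<^esub>"
        using \<alpha>p[of p] abd(5) cR dG by (simp flip: G.conj_pow)
      moreover have "\<theta> ?\<beta> [^]\<^bsub>A\<^esub> p = \<one>\<^bsub>A\<^esub>" using fp EF cE by blast
      ultimately show "(\<Otimes>\<^bsub>A\<^esub>j\<in>{..<p}. f x (((\<lambda>c. c #> y) ^^ j) c)) = \<one>\<^bsub>A\<^esub>"
        using A.finprod_arith_powers[OF \<theta>_closed[OF \<alpha>S] \<theta>_closed[OF \<beta>S] _ _ p(2)] by simp
    qed
    also have "{c \<in> E. c #> y = c} = Fix"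
    proof (intro equalityI subsetI)
      fix c assume c: "c \<in> {c \<in> E. c #> y = c}"
      then have cR: "c \<in> R" and cC: "\<And>s. s \<in> C \<Longrightarrow> c #> s = c" and cy: "c #> y = c" by (auto simp: E_def)
      have "c #> s = c" if s: "s \<in> S" for s
      proof -
        have sG: "s \<in> carrier G" using s by simp
        obtain l :: nat where l: "s \<otimes> x = d [^] l \<otimes> (x \<otimes> s)" using comm s x by blast
        \<comment> \<open>\<open>S\<close> is generated by \<open>C\<close> and \<open>y\<close>:
          the commutators with \<open>x\<close> of \<open>s\<close> and of \<open>y [^] j\<close>
          are \<open>d [^] l\<close> and \<open>d [^] (i * j)\<close>. Choosing \<open>j\<close>
          with \<open>i * j\<close> congruent to \<open>l\<close> modulo \<open>p\<close> makes
          \<open>u\<close> commute with \<open>x\<close>.\<close>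
        have "coprime i p" using \<open>\<not> p dvd i\<close> p(1) by (metis coprime_commute prime_imp_coprime)
        then obtain j' where "[i * j' = 1] (mod p)" using cong_solve_coprime_nat by auto
        then have "[i * j' * l = 1 * l] (mod p)" by (rule cong_scalar_right)
        then obtain j where "[i * j = l] (mod p)" by (auto simp: mult.assoc)
        then have dl: "d [^] l = d [^] (i * j)" using G.pow_cong[OF dG abd(5)] cong_sym by blast
        define u where "u = inv (y [^] j) \<otimes> s"
        have yj: "y [^] j \<in> S" "y [^] j \<in> carrier G" using pow_in_S[OF y(1)] yG by auto
        have uS: "u \<in> S" using yj s by (simp add: u_def)
        have s_eq: "s = y [^] j \<otimes> u" using yj sG by (simp add: u_def G.inv_mult_cancel)
        have "y [^] j \<otimes> (u \<otimes> x) = d [^] (i * j) \<otimes> (x \<otimes> y [^] j) \<otimes> u"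
          using l dl s_eq yj uS xG dG by (simp add: G.m_assoc)
        also have "\<dots> = y [^] j \<otimes> (x \<otimes> u)"
          using pow_commute_past[OF y(1) x(1) i, of j] yj uS xG dG by (simp add: G.m_assoc[symmetric])
        finally have "u \<otimes> x = x \<otimes> u" using yj uS xG by simp
        then have "u \<in> C" using uS by (simp add: C_def)
        have "c #> s = c #> y [^] j #> u"
          using s_eq yj uS rcoset_subset[OF cR] by (simp add: G.coset_mult_assoc)
        also have "\<dots> = c" using G.fixed_r_coset_pow[OF rcoset_subset[OF cR] yG cy] cC[OF \<open>u \<in> C\<close>] by simp
        finally show ?thesis .
      qed
      then show "c \<in> Fix" using cR by (simp add: Fix_def)
    qed (use y in \<open>auto simp: Fix_def E_def C_def\<close>)
    finally show ?thesis .
  qed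
  finally show ?thesis by (simp add: T_def)
qed

section \<open>The homomorphism \<open>T\<close> given by the normalizer of \<open>S\<close>\<close>

lemma Fix_conj:
  assumes "c \<in> Fix" "s \<in> S"
  shows "rep c \<otimes> s \<otimes> inv (rep c) \<in> S"
proof -
  have c: "c \<in> R" "c #> s = c" using assms by (auto simp: Fix_def)
  show ?thesis by (rule \<theta>_conj_rep(1)[OF c(1) S.mem_carrier[OF assms(2)] c(2) rep_in[OF c(1)]])
qed

lemma f_closed: "c \<in> Fix \<Longrightarrow> s \<in> S \<Longrightarrow> f s c \<in> carrier A"
  by (rule \<theta>_closed) (rule Fix_conj)

lemma finite_Fix [simp]: "finite Fix"
  by (simp add: Fix_def)

lemma Fix_rep [simp]: "c \<in> Fix \<Longrightarrow> rep c \<in> carrier G"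
  by (simp add: Fix_def)

text \<open>A representative of a fixed coset conjugates \<open>S\<close> into itself, so each such
  coset contributes a homomorphism, and these can be multiplied because \<open>A\<close> is
  abelian.\<close>

lemma T_hom: "T \<in> hom (G\<lparr>carrier := S\<rparr>) A"
proof (rule homI)
  fix s assume "s \<in> carrier (G\<lparr>carrier := S\<rparr>)"
  then show "T s \<in> carrier A" unfolding T_def by (intro A.finprod_closed) (auto simp: f_closed)
next
  fix s t assume "s \<in> carrier (G\<lparr>carrier := S\<rparr>)" "t \<in> carrier (G\<lparr>carrier := S\<rparr>)"
  then have st: "s \<in> S" "t \<in> S" by auto
  have "f (s \<otimes> t) c = f s c \<otimes>\<^bsub>A\<^esub> f t c" if c: "c \<in> Fix" for c
  proof -
    have "rep c \<otimes> (s \<otimes> t) \<otimes> inv (rep c) = (rep c \<otimes> s \<otimes> inv (rep c)) \<otimes> (rep c \<otimes> t \<otimes> inv (rep c))"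
      using c st by (simp add: G.m_assoc G.inv_mult_cancel)
    then show ?thesis using \<theta>_mult[OF Fix_conj[OF c st(1)] Fix_conj[OF c st(2)]] by simp
  qed
  then have "T (s \<otimes> t) = (\<Otimes>\<^bsub>A\<^esub>c\<in>Fix. f s c \<otimes>\<^bsub>A\<^esub> f t c)"
    unfolding T_def using st by (intro A.finprod_cong') (auto simp: f_closed)
  also have "\<dots> = T s \<otimes>\<^bsub>A\<^esub> T t"
    unfolding T_def using st by (intro A.finprod_multf) (auto simp: f_closed)
  finally show "T (s \<otimes>\<^bsub>G\<lparr>carrier := S\<rparr>\<^esub> t) = T s \<otimes>\<^bsub>A\<^esub> T t" by simp
qed

sublocale T: group_hom "G\<lparr>carrier := S\<rparr>" A T
  using T_hom \<theta>.G.group_axioms A.is_group by (simp add: group_hom_def group_hom_axioms_def)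

text \<open>Here it matters that \<open>d\<close> is itself a commutator, of \<open>a\<close> and
  \<open>b\<close>: its conjugates are commutators of elements of \<open>S\<close> and die in
  \<open>A\<close>.\<close>

lemma ker_subset_ker_T:
  assumes "s \<in> S" "\<theta> s = \<one>\<^bsub>A\<^esub>"
  shows "T s = \<one>\<^bsub>A\<^esub>"
proof -
  note dG = S.mem_carrier[OF abd(3)]
  have "f d c = \<one>\<^bsub>A\<^esub>" if c: "c \<in> Fix" for c
  proof -
    let ?c = "\<lambda>s. rep c \<otimes> s \<otimes> inv (rep c)"
    have "?c a \<otimes> ?c b = ?c (a \<otimes> b)" "?c d \<otimes> (?c b \<otimes> ?c a) = ?c (d \<otimes> (b \<otimes> a))"
      using c abd(1-3) by (simp_all add: G.m_assoc G.inv_mult_cancel)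
    then have "?c a \<otimes> ?c b = ?c d \<otimes> (?c b \<otimes> ?c a)" using abd(4) by simp
    then have "f a c \<otimes>\<^bsub>A\<^esub> f b c = f d c \<otimes>\<^bsub>A\<^esub> (f b c \<otimes>\<^bsub>A\<^esub> f a c)"
      using Fix_conj[OF c] abd(1-3) by (metis \<theta>_mult S.m_closed)
    then have "\<one>\<^bsub>A\<^esub> \<otimes>\<^bsub>A\<^esub> (f b c \<otimes>\<^bsub>A\<^esub> f a c) = f d c \<otimes>\<^bsub>A\<^esub> (f b c \<otimes>\<^bsub>A\<^esub> f a c)"
      using Fix_conj[OF c] abd(1-3) by (simp add: A.m_comm)
    then show ?thesis using Fix_conj[OF c] abd(1-3)
      by (metis A.m_closed A.one_closed A.right_cancel \<theta>_closed)
  qed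
  then have "T d = (\<Otimes>\<^bsub>A\<^esub>c\<in>Fix. \<one>\<^bsub>A\<^esub>)" unfolding T_def by (intro A.finprod_cong') auto
  then have "T d = \<one>\<^bsub>A\<^esub>" by simp
  moreover obtain i :: nat where "s = d [^] i" using ker assms by auto
  ultimately show ?thesis using T.hom_nat_pow[of d i] abd(3) by (simp flip: G.nat_pow_consistent)
qed

lemma card_Fix: "[card R = card Fix] (mod p)"
  unfolding Fix_def
  using rcoset_subset by (intro G.card_cong_fixed_r_cosets[OF sub card_S p(1)]) auto

text \<open>The image of \<open>T\<close> is not contained in any maximal subgroup, because modulo such a subgroup \<open>T\<close>
  is the power map with exponent \<open>card Fix\<close>. So \<open>T\<close> is onto, and by counting its kernel is that of \<open>\<theta>\<close>.\<close>
lemma kernel_T: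
  assumes cop: "coprime (p - 1) (order G)" and ind: "\<not> p dvd card R"
    and norm: "\<And>M c m. maximal_subgroup M (G\<lparr>carrier := S\<rparr>) \<Longrightarrow> c \<in> Fix \<Longrightarrow> m \<in> M \<Longrightarrow>
      rep c \<otimes> m \<otimes> inv (rep c) \<in> M"
    and s: "s \<in> S" "T s = \<one>\<^bsub>A\<^esub>"
  shows "\<theta> s = \<one>\<^bsub>A\<^esub>"
proof -
  let ?S = "G\<lparr>carrier := S\<rparr>"
  have finS: "finite S" using fin S.subset finite_subset by blast
  have oS: "order ?S = p ^ k" using card_S by (simp add: order_def)
  \<comment> \<open>The image of \<open>T\<close> is pulled back along \<open>\<theta>\<close>, so
    that a maximal subgroup above it lives in \<open>S\<close>, where the normalizer hypothesis
    applies.\<close>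
  define B where "B = {s \<in> S. \<exists>t\<in>S. \<theta> s = T t}"
  have Bsub: "subgroup B ?S"
  proof (rule \<theta>.G.finite_subgroupI)
    show "B \<noteq> {}" using T.hom_one by (auto simp: B_def intro!: exI[of _ \<one>] bexI[of _ \<one>])
    fix x y assume "x \<in> B" "y \<in> B"
    then obtain t u where "x \<in> S" "y \<in> S" "t \<in> S" "u \<in> S" "\<theta> x = T t" "\<theta> y = T u" by (auto simp: B_def)
    moreover then have "\<theta> (x \<otimes> y) = T (t \<otimes> u)" using T.hom_mult[of t u] by (simp add: \<theta>_mult)
    ultimately show "x \<otimes>\<^bsub>?S\<^esub> y \<in> B" by (auto simp: B_def)
  qed (use finS in \<open>auto simp: B_def\<close>)
  have "B = S"
  proof (rule ccontr)
    assume "B \<noteq> S"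
    then obtain M where M: "maximal_subgroup M ?S" "B \<subseteq> M"
      using \<theta>.G.exists_maximal_subgroup[of B] Bsub finS by auto
    interpret M: normal M ?S by (rule \<theta>.G.maximal_subgroup_p_group_normal[OF oS p(1) M(1)])
    have MG: "subgroup M G" using G.incl_subgroup[OF sub M.subgroup_axioms] .
    interpret MG: subgroup M G by (rule MG)
    have MS: "M \<subseteq> S" using M.subset by simp
    have conjM: "t \<otimes> m \<otimes> inv t \<in> M" if "t \<in> S" "m \<in> M" for t m
      using M.inv_op_closed2[of t m] that by (simp add: G.m_inv_consistent[OF sub])
    have "M \<noteq> S" using M(1) by (auto simp: maximal_subgroup_def)
    then obtain t where t: "t \<in> S" "t \<notin> M" using MS by blast
    have tG: "t \<in> carrier G" using t by simp
    have tp: "t [^] p \<in> M"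
      using \<theta>.G.maximal_subgroup_p_group_pow[OF oS p(1) M(1), of t] t by (simp flip: G.nat_pow_consistent)
    have step: "rep c \<otimes> t \<otimes> inv (rep c) \<in> M #> t" if c: "c \<in> Fix" for c
    proof -
      obtain i :: nat where "rep c \<otimes> t \<otimes> inv (rep c) \<in> M #> t [^] i"
        using \<theta>.G.maximal_normal_subgroup_cover[OF _ M(1) M.normal_axioms, of t "rep c \<otimes> t \<otimes> inv (rep c)"]
          t Fix_conj[OF c t(1)] finS by (auto simp flip: G.nat_pow_consistent)
      then show ?thesis
        using G.conj_trivial_mod[OF MG tG conjM[OF t(1)] t(2) tp p(1) cop fin Fix_rep[OF c] norm[OF M(1) c]]
        by simp
    qed
    \<comment> \<open>Every fixed coset contributes an element congruent to \<open>t\<close> modulo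
      \<open>M\<close>, so the product over \<open>Y\<close> lifts to an element congruent to
      \<open>t [^] card Y\<close>.\<close>
    have "\<exists>u \<in> M #> t [^] card Y. u \<in> S \<and> finprod A (f t) Y = \<theta> u" if "Y \<subseteq> Fix" for Y
    proof -
      have "finite Y" by (rule finite_subset[OF that finite_Fix])
      then show ?thesis using that
      proof (induction Y rule: finite_induct)
        case empty
        show ?case using MG.subset by (auto intro!: bexI[of _ \<one>])
      next
        case (insert c Y)
        then obtain u where u: "u \<in> M #> t [^] card Y" "u \<in> S" "finprod A (f t) Y = \<theta> u" by auto
        let ?v = "rep c \<otimes> t \<otimes> inv (rep c)"
        have v: "?v \<in> M #> t" "?v \<in> S" using insert step Fix_conj[OF _ t(1)] by auto
        have fY: "f t \<in> Y \<rightarrow> carrier A" using insert Fix_conj[OF _ t(1)] by auto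
        have "finprod A (f t) (insert c Y) = \<theta> (?v \<otimes> u)"
          using A.finprod_insert[OF insert(1,2) fY] v u by (simp add: \<theta>_mult)
        moreover have "?v \<otimes> u \<in> M #> t [^] card (insert c Y)"
        proof -
          obtain m m' where m: "m \<in> M" "?v = m \<otimes> t" "m' \<in> M" "u = m' \<otimes> t [^] card Y"
            using u v by (auto simp: r_coset_def)
          have "?v \<otimes> u = (m \<otimes> (t \<otimes> m' \<otimes> inv t)) \<otimes> (t \<otimes> t [^] card Y)"
            unfolding m(2,4) using m(1,3) tG by (simp add: G.m_assoc G.inv_mult_cancel)
          also have "t \<otimes> t [^] card Y = t [^] card (insert c Y)"
            using insert(1,2) G.nat_pow_Suc2[OF tG] by simp
          finally show ?thesis using m(1) conjM[OF t(1) m(3)] by (auto simp: r_coset_def)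
        qed
        ultimately show ?case using u v by blast
      qed
    qed
    from this[OF order_refl] obtain u where u: "u \<in> M #> t [^] card Fix" "u \<in> S" "T t = \<theta> u"
      by (auto simp: T_def)
    \<comment> \<open>\<open>u\<close> lies in \<open>B\<close> because its image is the value
      \<open>T t\<close>; this makes \<open>t [^] card Fix\<close> an element of
      \<open>M\<close>.\<close>
    then have "u \<in> M" using t(1) M(2) by (force simp: B_def)
    moreover obtain m where m: "m \<in> M" "u = m \<otimes> t [^] card Fix" using u by (auto simp: r_coset_def)
    ultimately have "inv m \<otimes> u \<in> M" by simp
    then have "t [^] card Fix \<in> M" using m tG by (simp add: G.inv_mult_cancel)
    then have "p dvd card Fix" by (rule G.pow_mem_imp_prime_dvd[OF MG tG t(2) tp p(1)])
    then show False using ind cong_dvd_iff[OF card_Fix] by simp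
  qed
  then have "\<theta> ` S \<subseteq> T ` S" by (auto simp: B_def)
  moreover have "finite (T ` S)" using finS by simp
  ultimately have im: "card (\<theta> ` S) \<le> card (T ` S)" by (intro card_mono)
  have "kernel ?S A \<theta> = kernel ?S A T"
  proof (rule card_seteq)
    show "finite (kernel ?S A T)" using finS by (simp add: kernel_def)
    show "kernel ?S A \<theta> \<subseteq> kernel ?S A T" using ker_subset_ker_T by (auto simp: kernel_def)
    have "card (kernel ?S A T) * card (T ` S) = card (kernel ?S A \<theta>) * card (\<theta> ` S)"
      using T.order_eq_card_kernel_image \<theta>.order_eq_card_kernel_image by simp
    also have "\<dots> \<le> card (kernel ?S A \<theta>) * card (T ` S)" using im by simp
    finally have "card (kernel ?S A T) * card (T ` S) \<le> card (kernel ?S A \<theta>) * card (T ` S)" .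
    moreover have "S \<noteq> {}" using S.one_closed by blast
    then have "0 < card (T ` S)" using finS by (simp add: card_gt_0_iff)
    ultimately show "card (kernel ?S A T) \<le> card (kernel ?S A \<theta>)" by simp
  qed
  then show ?thesis using s by (auto simp: kernel_def)
qed

section \<open>Reduction to the kernel of the transfer\<close>

lemma class2_p_nilpotent:
  assumes cop: "coprime (p - 1) (order G)" and ind: "\<not> p dvd card R"
    and norm: "\<And>M c m. maximal_subgroup M (G\<lparr>carrier := S\<rparr>) \<Longrightarrow> c \<in> Fix \<Longrightarrow> m \<in> M \<Longrightarrow>
      rep c \<otimes> m \<otimes> inv (rep c) \<in> M"
  shows "p_nilpotent p G"
proof -
  let ?S = "G\<lparr>carrier := S\<rparr>"
  have finS: "finite S" using fin S.subset finite_subset by blast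
  note dG = S.mem_carrier[OF abd(3)]
  interpret V: group_hom G A V using V_hom by (simp add: group_hom_def group_hom_axioms_def)
  define K where "K = kernel G A V"
  let ?K = "G\<lparr>carrier := K\<rparr>"
  have K: "K \<lhd> G" unfolding K_def by (rule V.normal_kernel)
  interpret K: normal K G by (rule K)
  interpret KG: group ?K by (rule K.subgroup_is_group[OF G.is_group])
  have K_iff: "x \<in> K \<longleftrightarrow> x \<in> carrier G \<and> V x = \<one>\<^bsub>A\<^esub>" for x unfolding K_def kernel_def by blast
  define Q where "Q = K \<inter> S"
  have QG: "subgroup Q G" unfolding Q_def by (rule G.subgroups_Inter_pair[OF K.subgroup_axioms sub])
  have QK: "subgroup Q ?K" using QG K.subgroup_axioms by (intro G.subgroup_incl) (auto simp: Q_def)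
  have "{x \<in> Q. x [^] p = \<one>} \<subseteq> (\<lambda>i::nat. d [^] i) ` {..<p}"
  proof
    fix x assume x: "x \<in> {x \<in> Q. x [^] p = \<one>}"
    then have xS: "x \<in> S" and xp: "x [^] p = \<one>" and "V x = \<one>\<^bsub>A\<^esub>"
      using K_iff[of x] by (auto simp: Q_def)
    then have "T x = \<one>\<^bsub>A\<^esub>" using V_eq_T[OF xS xp] by simp
    then have "\<theta> x = \<one>\<^bsub>A\<^esub>" using kernel_T[OF cop ind _ xS] norm by blast
    then obtain i :: nat where "x = d [^] i" using ker[OF xS] by blast
    moreover have "d [^] i = d [^] (i mod p)"
      by (rule G.pow_cong[OF dG abd(5)]) (simp add: unique_euclidean_semiring_class.cong_def)
    ultimately show "x \<in> (\<lambda>i::nat. d [^] i) ` {..<p}" using prime_gt_0_nat[OF p(1)] by simp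
  qed
  then have "card {x \<in> Q. x [^] p = \<one>} \<le> card ((\<lambda>i::nat. d [^] i) ` {..<p})" by (intro card_mono) auto
  also have "\<dots> \<le> p" using card_image_le[of "{..<p}"] by simp
  finally have few: "card {x \<in> Q. x [^] p = \<one>} \<le> p" .
  have abel: "x \<otimes> y = y \<otimes> x" if "x \<in> Q" "y \<in> Q" for x y
    using subgroup_few_abelian[OF QG _ few that] by (simp add: Q_def)
  have pw: "\<exists>j. n = p ^ j" if "n dvd p ^ m" for n m
    using that p(1) by (metis divides_primepow_nat)
  have "card S = card (kernel ?S A \<theta>) * card (carrier A)"
    using \<theta>.order_eq_card_kernel_image onto by (simp add: order_def)
  then obtain e where e: "card (carrier A) = p ^ e" using card_S pw by (metis dvd_triv_right)
  have "card (V ` carrier G) dvd card (carrier A)"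
    using A.lagrange[OF V.img_is_subgroup] unfolding order_def by (metis dvd_triv_right)
  then obtain v where v: "card (V ` carrier G) = p ^ v" using e pw by metis
  have oG: "order G = p ^ v * card K"
    using V.order_eq_card_kernel_image v by (simp add: K_def mult.commute)
  interpret VS: group_hom ?S A V
    using V_hom \<theta>.G.group_axioms A.is_group
    by (simp add: group_hom_def group_hom_axioms_def hom_def Pi_def)
  have "card (rcosets\<^bsub>A\<^esub> (V ` S)) * card (V ` S) = card (carrier A)"
    using A.lagrange[OF VS.img_is_subgroup] by (simp add: order_def)
  then have "card (V ` S) dvd card (carrier A)" by (metis dvd_triv_right)
  then obtain u where u: "card (V ` S) = p ^ u" using e pw by metis
  have oS: "card S = p ^ u * card Q"
  proof -
    have "kernel ?S A V = {x \<in> S. V x = \<one>\<^bsub>A\<^esub>}" by (simp add: kernel_def)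
    also have "\<dots> = Q" unfolding Q_def using K_iff S.subset by blast
    finally have "kernel ?S A V = Q" .
    then show ?thesis using VS.order_eq_card_kernel_image u by (simp add: order_def mult.commute)
  qed
  \<comment> \<open>Comparing the kernels of \<open>V\<close> on \<open>S\<close> and on
    \<open>G\<close> shows that the index of \<open>Q\<close> in \<open>K\<close> divides that of
    \<open>S\<close> in \<open>G\<close>. So \<open>Q\<close> is a Sylow subgroup of
    \<open>K\<close>.\<close>
  have "card (V ` S) \<le> card (V ` carrier G)"
    using fin S.subset by (intro card_mono) auto
  then have uv: "u \<le> v" using u v prime_gt_1_nat[OF p(1)] by simp
  let ?i = "card (rcosets\<^bsub>?K\<^esub> Q)"
  have "?i * card Q = card K" using KG.lagrange[OF QK] by (simp add: order_def)
  moreover have "card R * card S = order G" using G.lagrange[OF sub] .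
  moreover have "p ^ v = p ^ (v - u) * p ^ u" using uv by (simp flip: power_add)
  ultimately have "card R * p ^ u * card Q = ?i * p ^ (v - u) * p ^ u * card Q"
    using oG oS by (metis mult.assoc mult.commute)
  moreover have "card Q > 0" using subgroup.finite_imp_card_positive[OF QG fin] .
  ultimately have "card R = ?i * p ^ (v - u)" using prime_gt_0_nat[OF p(1)] by simp
  then have ip: "\<not> p dvd ?i" using ind by (metis dvd_mult2)
  obtain q where q: "card Q = p ^ q" using oS card_S pw by (metis dvd_triv_right)
  have "card K dvd order G" using oG by simp
  then have cK: "coprime (p - 1) (order ?K)" using cop
      coprime_divisors[OF dvd_refl, of "card K" "order G"] by (simp add: order_def)
  have "\<exists>N. N \<lhd> ?K \<and> \<not> p dvd card N \<and> (\<exists>j. order ?K = p ^ j * card N)"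
  proof (rule KG.normal_complement_abelian[OF _ p(1) cK QK q ip])
    show "finite (carrier ?K)" using finite_subset[OF K.subset fin] by simp
    show "card {x \<in> Q. x [^]\<^bsub>?K\<^esub> p = \<one>\<^bsub>?K\<^esub>} \<le> p"
      using few by (simp flip: G.nat_pow_consistent)
  qed (use abel in auto)
  then obtain N j where "N \<lhd> ?K" "\<not> p dvd card N" "card K = p ^ j * card N"
    by (auto simp: order_def)
  then show ?thesis using G.p_nilpotent_extension[OF p(1) K oG] by blast
qed

end

section \<open>Sylow subgroups with subnormalizer conditions\<close>

text \<open>Conjugation is injective, so on a finite \<open>H\<close> stability already means
  equality.\<close>

lemma (in group) mem_normalizer_iff:
  assumes "finite H" "H \<subseteq> carrier G" "r \<in> carrier G"
  shows "r \<in> normalizer G H \<longleftrightarrow> (\<forall>h\<in>H. r \<otimes> h \<otimes> inv r \<in> H)"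
proof -
  let ?c = "\<lambda>h. r \<otimes> h \<otimes> inv r"
  have im: "r <# H #> inv r = ?c ` H" by (auto simp: l_coset_def r_coset_def)
  have "inj_on ?c H"
    using assms by (intro inj_onI) (simp add: subset_iff)
  then have "?c ` H = H \<longleftrightarrow> (\<forall>h\<in>H. ?c h \<in> H)"
    using endo_inj_surj[OF assms(1), of ?c] by blast
  then show ?thesis using assms im by (simp add: normalizer_def stabilizer_def)
qed

lemma (in group) cyclic_card_power_eq_one:
  assumes "cyclic_group G" "finite (carrier G)" "0 < p"
  shows "card {x \<in> carrier G. x [^] (p::nat) = \<one>} \<le> p"
proof -
  obtain g where g: "g \<in> carrier G" "carrier G = range (\<lambda>n::int. g [^] n)"
    using assms(1) cyclic_group by auto
  have n: "ord g > 0" using ord_ge_1[OF assms(2) g(1)] by simp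
  \<comment> \<open>The condition on \<open>g [^] i\<close> is that \<open>ord g\<close> divides
    \<open>i * p\<close>, that is, \<open>?q\<close> divides \<open>i\<close>; this leaves
    \<open>?e\<close> exponents below \<open>ord g\<close>.\<close>
  let ?q = "ord g div gcd (ord g) p" and ?e = "gcd (ord g) p"
  have "x \<in> (\<lambda>m::nat. g [^] (?q * m)) ` {..<?e}" if x: "x \<in> carrier G" "x [^] p = \<one>" for x
  proof -
    obtain z :: int where "x = g [^] z" using g x by blast
    moreover have "g [^] z = g [^] (nat (z mod int (ord g)))"
      using g(1) n by (simp flip: int_pow_int add: int_pow_eq mod_eq_dvd_iff[symmetric])
    ultimately obtain i :: nat where i: "x = g [^] i" "i < ord g" using n
      by (metis Euclidean_Rings.pos_mod_bound Euclidean_Rings.pos_mod_sign nat_less_iff of_nat_0_less_iff)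
    have "ord g dvd i * p" using x(2) i(1) g(1) pow_eq_id by (simp add: nat_pow_pow)
    then have "?q dvd i"
      using n by (metis div_dvd_iff_mult dvd_mult gcd_dvd1 gcd_mult_distrib_nat gcd_greatest gr_implies_not0 dvd_triv_right gcd_eq_0_iff)
    then obtain m where m: "i = ?q * m" by auto
    have "?q * ?e = ord g" by simp
    then have "m < ?e" using i(2) m n by (metis mult_less_cancel1)
    then show ?thesis using i m by auto
  qed
  then have "card {x \<in> carrier G. x [^] p = \<one>} \<le> card ((\<lambda>m::nat. g [^] (?q * m)) ` {..<?e})"
    by (intro card_mono) auto
  also have "\<dots> \<le> ?e" using card_image_le[of "{..<?e}"] by simp
  also have "\<dots> \<le> p" using assms(3) by (simp add: gcd_le2_nat)
  finally show ?thesis .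
qed

lemma (in group) sylow_index_not_dvd:
  assumes "finite (carrier G)" "Factorial_Ring.prime p" "sylow_subgroup p S G"
  shows "\<not> p dvd card (rcosets S)"
proof
  let ?m = "multiplicity p (order G)"
  assume "p dvd card (rcosets S)"
  then have "p * p ^ ?m dvd card (rcosets S) * p ^ ?m" by (rule mult_dvd_mono) simp
  moreover have "card (rcosets S) * p ^ ?m = order G"
    using lagrange[of S] assms(3) by (simp add: sylow_subgroup_def)
  ultimately have "p ^ Suc ?m dvd order G" by simp
  moreover have "order G \<noteq> 0" using assms(1) order_gt_0_iff_finite by auto
  ultimately have "Suc ?m \<le> ?m"
    using assms(2) by (meson not_prime_unit power_dvd_iff_le_multiplicity)
  then show False by simp
qed

lemma (in group) p_nilpotent_sylow_subnormalizer:
  fixes p :: nat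
  assumes fin: "finite (carrier G)" and p: "Factorial_Ring.prime p" "odd p"
    and cop: "coprime (p - 1) (order G)" and syl: "sylow_subgroup p S G"
    and cond: "\<And>M. maximal_subgroup M (G\<lparr>carrier := S\<rparr>) \<Longrightarrow> subnormalizer_condition G S M"
    and maxs: "\<not> cyclic_group (G\<lparr>carrier := S\<rparr>) \<Longrightarrow>
      \<exists>M1 M2. M1 \<noteq> M2 \<and>
        maximal_subgroup M1 (G\<lparr>carrier := S\<rparr>) \<and> comm_group (G\<lparr>carrier := M1\<rparr>) \<and>
        maximal_subgroup M2 (G\<lparr>carrier := S\<rparr>) \<and> comm_group (G\<lparr>carrier := M2\<rparr>)"
  shows "p_nilpotent p G"
proof -
  let ?S = "G\<lparr>carrier := S\<rparr>"
  have sub: "subgroup S G" and cS: "card S = p ^ multiplicity p (order G)"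
    using syl by (auto simp: sylow_subgroup_def)
  interpret S: subgroup S G by (rule sub)
  interpret SG: group ?S by (rule S.subgroup_is_group[OF is_group])
  have finS: "finite S" using fin S.subset finite_subset by blast
  note ind = sylow_index_not_dvd[OF fin p(1) syl]
  show ?thesis
  proof (cases "cyclic_group ?S")
    case True
    then interpret SC: comm_group ?S by (rule SG.cyclic_imp_abelian_group)
    have "card {x \<in> S. x [^] p = \<one>} \<le> p"
      using SG.cyclic_card_power_eq_one[OF True, of p] finS prime_gt_0_nat[OF p(1)]
      by (simp flip: nat_pow_consistent)
    moreover have "x \<otimes> y = y \<otimes> x" if "x \<in> S" "y \<in> S" for x y
      using SC.m_comm[of x y] that by simp
    ultimately obtain N j where "N \<lhd> G" "\<not> p dvd card N" "order G = p ^ j * card N"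
      using normal_complement_abelian[OF fin p(1) cop sub cS ind] by blast
    then show ?thesis by (rule p_nilpotentI)
  next
    case False
    then obtain M1 M2 where M: "M1 \<noteq> M2" "maximal_subgroup M1 ?S" "comm_group (G\<lparr>carrier := M1\<rparr>)"
      "maximal_subgroup M2 ?S" "comm_group (G\<lparr>carrier := M2\<rparr>)" using maxs by blast
    have oS: "order ?S = p ^ multiplicity p (order G)" using cS by (simp add: order_def)
    obtain a b d where abd: "a \<in> carrier ?S" "b \<in> carrier ?S" "d \<in> carrier ?S"
      "a \<otimes>\<^bsub>?S\<^esub> b = d \<otimes>\<^bsub>?S\<^esub> (b \<otimes>\<^bsub>?S\<^esub> a)" "d [^]\<^bsub>?S\<^esub> p = \<one>\<^bsub>?S\<^esub>"
      "\<And>x. x \<in> carrier ?S \<Longrightarrow> d \<otimes>\<^bsub>?S\<^esub> x = x \<otimes>\<^bsub>?S\<^esub> d"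
      "\<And>x y. x \<in> carrier ?S \<Longrightarrow> y \<in> carrier ?S \<Longrightarrow> \<exists>i::nat. x \<otimes>\<^bsub>?S\<^esub> y = d [^]\<^bsub>?S\<^esub> i \<otimes>\<^bsub>?S\<^esub> (y \<otimes>\<^bsub>?S\<^esub> x)"
      "\<And>x y. x \<in> carrier ?S \<Longrightarrow> y \<in> carrier ?S \<Longrightarrow> x [^]\<^bsub>?S\<^esub> p \<otimes>\<^bsub>?S\<^esub> y = y \<otimes>\<^bsub>?S\<^esub> x [^]\<^bsub>?S\<^esub> p"
      by (rule SG.two_abelian_maximal_subgroups[OF oS p(1) M(2,4,1)])
        (use comm_group.axioms(1)[OF M(3), THEN comm_monoid.m_comm]
          comm_group.axioms(1)[OF M(5), THEN comm_monoid.m_comm] in auto)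
    have dS: "d \<in> S" using abd(3) by simp
    have dpow: "d [^] (i::nat) \<in> S" for i by (induction i) (use dS in auto)
    have dcent: "d [^] (i::nat) \<otimes> x = x \<otimes> d [^] i" if "x \<in> S" for i x
      by (rule group_commutes_pow) (use that abd(6) dS in auto)
    have comm: "\<exists>i::nat. x \<otimes> y = d [^] i \<otimes> (y \<otimes> x)" if "x \<in> S" "y \<in> S" for x y
      using abd(7)[of x y] that by (simp flip: nat_pow_consistent)
    \<comment> \<open>\<open>D\<close> is central and, by \<open>comm\<close>, contains every
      commutator of \<open>S\<close>, so the quotient by it is an abelian target for the transfer
      with kernel exactly the powers of \<open>d\<close>.\<close>
    define D where "D = range (\<lambda>i::nat. d [^] i)"
    have DS: "D \<subseteq> S" using dpow by (auto simp: D_def)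
    have DG: "subgroup D G"
      by (rule finite_subgroupI[OF fin])
        (use DS S.subset nat_pow_mult[OF S.mem_carrier[OF dS]] in \<open>auto simp: D_def\<close>)
    then have DSG: "subgroup D ?S" using DS sub by (intro subgroup_incl)
    have "D \<lhd> ?S"
      unfolding SG.normal_inv_iff
    proof (intro conjI ballI DSG)
      fix x h assume "x \<in> carrier ?S" "h \<in> D"
      then obtain i :: nat where x: "x \<in> S" "h = d [^] i" by (auto simp: D_def)
      then have "x \<otimes> h \<otimes> inv x = h" using dcent[OF x(1), of i, symmetric] dpow[of i] by (simp add: m_assoc)
      then show "x \<otimes>\<^bsub>?S\<^esub> h \<otimes>\<^bsub>?S\<^esub> inv\<^bsub>?S\<^esub> x \<in> D" using x(1) \<open>h \<in> D\<close> sub by (simp add: m_inv_consistent)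
    qed
    then interpret D: normal D ?S .
    interpret DG: subgroup D G by (rule DG)
    let ?A = "?S Mod D"
    interpret A: group ?A by (rule D.factorgroup_is_group)
    have hom: "(\<lambda>s. D #> s) \<in> hom ?S ?A" using D.r_coset_hom_Mod by simp
    have "comm_group ?A"
    proof (rule A.group_comm_groupI)
      fix c c' assume "c \<in> carrier ?A" "c' \<in> carrier ?A"
      then obtain x y where xy: "x \<in> S" "y \<in> S" "c = D #> x" "c' = D #> y"
        by (auto simp: carrier_FactGroup)
      obtain i :: nat where i: "x \<otimes> y = d [^] i \<otimes> (y \<otimes> x)" using comm xy by blast
      have "D #> (x \<otimes> y) = D #> d [^] i #> (y \<otimes> x)"
        using i xy dpow DG.subset by (simp add: coset_mult_assoc)
      also have "D #> d [^] i = D" using DG dpow by (intro coset_join2) (auto simp: D_def)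
      finally have "D #> (x \<otimes> y) = D #> (y \<otimes> x)" .
      then show "c \<otimes>\<^bsub>?A\<^esub> c' = c' \<otimes>\<^bsub>?A\<^esub> c"
        using hom_mult[OF hom, of x y] hom_mult[OF hom, of y x] xy by simp
    qed
    then interpret A: comm_group ?A .
    interpret class2_transfer G ?A S "\<lambda>s. D #> s" p "multiplicity p (order G)" d a b
    proof unfold_locales
      show "D #> s = \<one>\<^bsub>?A\<^esub> \<longleftrightarrow> s \<in> range (\<lambda>i::nat. d [^] i)" if "s \<in> S" for s
        using coset_join1[OF _ _ DG, of s] coset_join2[OF _ DG, of s] that DG.subset by (auto simp: D_def[symmetric])
      show "(\<lambda>s. D #> s) ` S = carrier ?A" by (auto simp: carrier_FactGroup)
    qed (use fin p sub cS hom abd comm in \<open>auto simp flip: nat_pow_consistent\<close>)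
    show ?thesis
    proof (rule class2_p_nilpotent[OF cop ind])
      fix M c m assume Mx: "maximal_subgroup M ?S" and c: "c \<in> Fix" and m: "m \<in> M"
      have MS: "M \<subseteq> S" using Mx subgroup.subset by (fastforce simp: maximal_subgroup_def)
      have "rep c \<in> normalizer G S"
        using mem_normalizer_iff[OF finS S.subset Fix_rep[OF c]] Fix_conj[OF c] by blast
      \<comment> \<open>The subnormalizer condition on \<open>M\<close>, taken at
        \<open>K = S\<close>, passes from the normalizer of \<open>S\<close> to that of
        \<open>M\<close>.\<close>
      then have "rep c \<in> normalizer G M"
        using cond[OF Mx] sub MS unfolding subnormalizer_condition_def by blast
      then show "rep c \<otimes> m \<otimes> inv (rep c) \<in> M"
        using mem_normalizer_iff[OF finite_subset[OF MS finS] order_trans[OF MS S.subset] Fix_rep[OF c]] m by blast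
    qed
  qed
qed

theorem corollary5p2:
  fixes G :: "('a, 'b) monoid_scheme" and p :: nat and S :: "'a set"
  assumes "group G" and "finite (carrier G)"
    and "Factorial_Ring.prime p" and "odd p" and "p dvd order G"
    and "coprime (p - 1) (order G)"
    and "sylow_subgroup p S G"
    and "\<And>M. maximal_subgroup M (G\<lparr>carrier := S\<rparr>) \<Longrightarrow> subnormalizer_condition G S M"
    and "\<not> cyclic_group (G\<lparr>carrier := S\<rparr>) \<Longrightarrow>
      \<exists>M1 M2. M1 \<noteq> M2 \<and>
        maximal_subgroup M1 (G\<lparr>carrier := S\<rparr>) \<and> comm_group (G\<lparr>carrier := M1\<rparr>) \<and>
        maximal_subgroup M2 (G\<lparr>carrier := S\<rparr>) \<and> comm_group (G\<lparr>carrier := M2\<rparr>)"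
  shows "p_nilpotent p G"
  using group.p_nilpotent_sylow_subnormalizer[OF assms(1-4,6-9)] .

end
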